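(* Let $2 \leq n < \infty$. The radial MASA $A_r \subset L\mathbb{F}_n$ satisfies the weak FC property, i.e. there exists a Haar unitary $u \in L\mathbb{F}_n$ that is freely independent of $A_r$.
   Context: $L\mathbb{F}_n$ is the free group factor with its canonical trace $\tau$, generated by the freely independent Haar unitaries $u_1, \dots, u_n$ associated with the free generators of $\mathbb{F}_n$. The radial MASA is $A_r = \{\sum_{i=1}^n (u_i + u_i^* )\}''$, the von Neumann algebra generated by $\sum_{i=1}^n (u_i+u_i^* )$. A Haar unitary is a unitary $u$ with $\tau(u^k) = 0$ for all integers $k \neq 0$. A unitary $u$ is freely independent of $A_r$ if the von Neumann algebras $\{u\}''$ and $A_r$ are freely independent with respect to $\tau$. *)

theory Defs
  imports "HOL-Analysis.Analysis"
begin

section \<open>Free groups\<close>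

text \<open>
  A letter \<open>(i, True)\<close> stands for the generator \<open>i\<close> and \<open>(i, False)\<close> for its inverse; the free
  group on \<open>'n\<close> is the set of reduced words.  It is an instance of \<^class>\<open>group_add\<close>, whose
  operation need not be commutative, so the group law is written additively.
\<close>

definition flip :: "'n \<times> bool \<Rightarrow> 'n \<times> bool" where
  "flip a = (fst a, \<not> snd a)"

definition reduced :: "('n \<times> bool) list \<Rightarrow> bool" where
  "reduced w \<longleftrightarrow> successively (\<lambda>a b. b \<noteq> flip a) w"

definition push :: "'n \<times> bool \<Rightarrow> ('n \<times> bool) list \<Rightarrow> ('n \<times> bool) list" where
  "push a w = (case w of [] \<Rightarrow> [a] | b # w' \<Rightarrow> if b = flip a then w' else a # w)"

lemma flip_flip [simp]: "flip (flip a) = a"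
  by (simp add: flip_def)

lemma flip_neq [simp]: "flip a \<noteq> a" "a \<noteq> flip a"
  by (auto simp: flip_def prod_eq_iff)

lemma flip_eq_iff: "flip a = b \<longleftrightarrow> a = flip b"
  by auto

lemma reduced_Nil [simp]: "reduced []"
  by (simp add: reduced_def)

lemma reduced_Cons: "reduced (a # w) \<longleftrightarrow> reduced w \<and> (w = [] \<or> hd w \<noteq> flip a)"
  by (auto simp: reduced_def successively_Cons)

lemma reduced_push: "reduced w \<Longrightarrow> reduced (push a w)"
  by (auto simp: push_def reduced_Cons split: list.splits)

lemma push_eq_Cons: "reduced (a # w) \<Longrightarrow> push a w = a # w"
  by (auto simp: push_def reduced_Cons split: list.splits)

lemma push_flip: "reduced w \<Longrightarrow> push (flip a) (push a w) = w"
  by (auto simp: push_def reduced_Cons split: list.splits)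

lemma reduced_foldr_push: "reduced w \<Longrightarrow> reduced (foldr push u w)"
  by (induction u) (auto simp: reduced_push)

lemma foldr_push_Nil: "reduced u \<Longrightarrow> foldr push u [] = u"
  by (induction u) (auto simp: push_eq_Cons, auto simp: reduced_Cons push_eq_Cons)

lemma foldr_push_push:
  assumes "reduced w"
  shows "foldr push (push a u) w = push a (foldr push u w)"
proof (cases u)
  case (Cons b v)
  show ?thesis
  proof (cases "b = flip a")
    case True
    then have "foldr push (push a u) w = foldr push v w"
      by (simp add: push_def Cons)
    also have "\<dots> = push (flip b) (push b (foldr push v w))"
      by (simp add: push_flip reduced_foldr_push assms)
    finally show ?thesis
      using True by (simp add: Cons)
  qed (simp add: push_def Cons)
qed (simp add: push_def)

lemma foldr_push_assoc:
  assumes "reduced w"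
  shows "foldr push (foldr push u v) w = foldr push u (foldr push v w)"
  by (induction u) (simp_all add: foldr_push_push assms)

lemma foldr_push_inverse:
  "reduced w \<Longrightarrow> foldr push (rev (map flip u)) (foldr push u w) = w"
  by (induction u arbitrary: w) (simp_all add: push_flip reduced_foldr_push)

lemma reduced_rev_map_flip: "reduced u \<Longrightarrow> reduced (rev (map flip u))"
  by (simp add: reduced_def successively_rev successively_map flip_eq_iff)
     (metis (mono_tags, lifting) flip_flip successively_mono)

typedef 'n free_group = "{w :: ('n \<times> bool) list. reduced w}"
  morphisms word Abs_free_group
  by (rule exI[of _ "[]"]) simp

setup_lifting type_definition_free_group

instantiation free_group :: (type) group_add
begin

lift_definition zero_free_group :: "'n free_group" is "[]" by simp

lift_definition plus_free_group :: "'n free_group \<Rightarrow> 'n free_group \<Rightarrow> 'n free_group"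
  is "foldr push" by (rule reduced_foldr_push)

lift_definition uminus_free_group :: "'n free_group \<Rightarrow> 'n free_group"
  is "\<lambda>w. rev (map flip w)" by (rule reduced_rev_map_flip)

definition minus_free_group :: "'n free_group \<Rightarrow> 'n free_group \<Rightarrow> 'n free_group" where
  "minus_free_group g h = g + (- h)"

instance
proof
  fix a b c :: "'n free_group"
  show "a + b + c = a + (b + c)"
    by transfer (rule foldr_push_assoc)
  show "0 + a = a"
    by transfer simp
  show "a + 0 = a"
    by transfer (rule foldr_push_Nil)
  show "- a + a = 0"
    by transfer (metis foldr_push_Nil foldr_push_inverse reduced_Nil)
  show "a + (- b) = a - b"
    by (simp add: minus_free_group_def)
qed

end

lift_definition gen :: "'n \<Rightarrow> 'n free_group" is "\<lambda>i. [(i, True)]"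
  by (simp add: reduced_Cons)


section \<open>The Hilbert space of square-summable functions\<close>

lemma square_summable_product:
  fixes f g :: "'a \<Rightarrow> complex"
  assumes "(\<lambda>a. (cmod (f a))\<^sup>2) summable_on A" "(\<lambda>a. (cmod (g a))\<^sup>2) summable_on A"
  shows "(\<lambda>a. f a * cnj (g a)) summable_on A"
proof -
  have "(\<lambda>a. cmod (f a * cnj (g a))) summable_on A"
  proof (rule summable_on_comparison_test)
    show "(\<lambda>a. (cmod (f a))\<^sup>2 + (cmod (g a))\<^sup>2) summable_on A"
      by (intro summable_on_add assms)
    fix a
    have "0 \<le> (cmod (f a) - cmod (g a))\<^sup>2" "0 \<le> (cmod (f a))\<^sup>2" "0 \<le> (cmod (g a))\<^sup>2"
      by auto
    then show "cmod (f a * cnj (g a)) \<le> (cmod (f a))\<^sup>2 + (cmod (g a))\<^sup>2"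
      unfolding norm_mult complex_mod_cnj power2_diff
      using mult_nonneg_nonneg[OF norm_ge_zero[of "f a"] norm_ge_zero[of "g a"]] by linarith
  qed auto
  then show ?thesis
    by (rule abs_summable_summable)
qed

lemma square_summable_add:
  fixes f g :: "'a \<Rightarrow> complex"
  assumes "(\<lambda>a. (cmod (f a))\<^sup>2) summable_on A" "(\<lambda>a. (cmod (g a))\<^sup>2) summable_on A"
  shows "(\<lambda>a. (cmod (f a + g a))\<^sup>2) summable_on A"
proof (rule summable_on_comparison_test)
  show "(\<lambda>a. 2 * (cmod (f a))\<^sup>2 + 2 * (cmod (g a))\<^sup>2) summable_on A"
    by (intro summable_on_add summable_on_cmult_right assms)
  fix a
  have "(cmod (f a + g a))\<^sup>2 \<le> (cmod (f a) + cmod (g a))\<^sup>2"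
    by (intro power_mono norm_triangle_ineq) auto
  moreover have "0 \<le> (cmod (f a) - cmod (g a))\<^sup>2"
    by simp
  ultimately show "(cmod (f a + g a))\<^sup>2 \<le> 2 * (cmod (f a))\<^sup>2 + 2 * (cmod (g a))\<^sup>2"
    by (simp add: power2_sum power2_diff)
qed auto

lemma square_summable_mult:
  fixes f :: "'a \<Rightarrow> complex"
  assumes "(\<lambda>a. (cmod (f a))\<^sup>2) summable_on A"
  shows "(\<lambda>a. (cmod (c * f a))\<^sup>2) summable_on A"
  unfolding norm_mult power_mult_distrib by (intro summable_on_cmult_right assms)

typedef 'a ell2 = "{f :: 'a \<Rightarrow> complex. (\<lambda>a. (cmod (f a))\<^sup>2) summable_on UNIV}"
  morphisms coef Abs_ell2
  by (rule exI[of _ "\<lambda>_. 0"]) simp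

setup_lifting type_definition_ell2

lemma ell2_eqI: "(\<And>a. coef x a = coef y a) \<Longrightarrow> x = y"
  by (simp add: coef_inject[symmetric] fun_eq_iff)

lift_definition scaleC :: "complex \<Rightarrow> 'a ell2 \<Rightarrow> 'a ell2"  (infixr "*\<^sub>C" 75)
  is "\<lambda>c f a. c * f a" by (rule square_summable_mult)

lift_definition cinner :: "'a ell2 \<Rightarrow> 'a ell2 \<Rightarrow> complex"
  is "\<lambda>f g. \<Sum>\<^sub>\<infinity>a. f a * cnj (g a)" .

lift_definition delta :: "'a \<Rightarrow> 'a ell2" is "\<lambda>a b. if b = a then 1 else 0"
proof -
  fix a :: 'a
  show "(\<lambda>b. (cmod (if b = a then 1 else 0))\<^sup>2) summable_on UNIV"
    by (rule finite_nonzero_values_imp_summable_on) (rule finite_subset[of _ "{a}"], auto)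
qed

instantiation ell2 :: (type) real_inner
begin

lift_definition zero_ell2 :: "'a ell2" is "\<lambda>_. 0" by simp

lift_definition plus_ell2 :: "'a ell2 \<Rightarrow> 'a ell2 \<Rightarrow> 'a ell2" is "\<lambda>f g a. f a + g a"
  by (rule square_summable_add)

lift_definition uminus_ell2 :: "'a ell2 \<Rightarrow> 'a ell2" is "\<lambda>f a. - f a" by simp

definition minus_ell2 :: "'a ell2 \<Rightarrow> 'a ell2 \<Rightarrow> 'a ell2" where
  "minus_ell2 x y = x + (- y)"

definition scaleR_ell2 :: "real \<Rightarrow> 'a ell2 \<Rightarrow> 'a ell2" where
  "scaleR_ell2 r x = complex_of_real r *\<^sub>C x"

definition inner_ell2 :: "'a ell2 \<Rightarrow> 'a ell2 \<Rightarrow> real" where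
  "inner_ell2 x y = Re (cinner x y)"

definition norm_ell2 :: "'a ell2 \<Rightarrow> real" where
  "norm_ell2 x = sqrt (inner x x)"

definition sgn_ell2 :: "'a ell2 \<Rightarrow> 'a ell2" where
  "sgn_ell2 x = inverse (norm x) *\<^sub>R x"

definition dist_ell2 :: "'a ell2 \<Rightarrow> 'a ell2 \<Rightarrow> real" where
  "dist_ell2 x y = norm (x - y)"

definition uniformity_ell2 :: "('a ell2 \<times> 'a ell2) filter" where
  "uniformity_ell2 = (INF e\<in>{0<..}. principal {(x, y). dist x y < e})"

definition open_ell2 :: "'a ell2 set \<Rightarrow> bool" where
  "open_ell2 U \<longleftrightarrow> (\<forall>x\<in>U. eventually (\<lambda>(x', y). x' = x \<longrightarrow> y \<in> U) uniformity)"

lemma cinner_summable: "(\<lambda>a. coef x a * cnj (coef y a)) summable_on UNIV"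
  using square_summable_product coef by blast

lemma cinner_add_left: "cinner (x + y) z = cinner x z + cinner y z"
  unfolding cinner.rep_eq plus_ell2.rep_eq
  by (simp add: ring_distribs infsum_add cinner_summable)

lemma cinner_scaleC_left: "cinner (c *\<^sub>C x) y = c * cinner x y"
  unfolding cinner.rep_eq scaleC.rep_eq
  by (simp add: mult.assoc infsum_cmult_right')

lemma cinner_commute: "cinner x y = cnj (cinner y x)"
  unfolding cinner.rep_eq infsum_cnj[symmetric] by (simp add: mult.commute)

lemma cinner_self: "cinner x x = complex_of_real (\<Sum>\<^sub>\<infinity>a. (cmod (coef x a))\<^sup>2)"
proof -
  have "cinner x x = (\<Sum>\<^sub>\<infinity>a. complex_of_real ((cmod (coef x a))\<^sup>2))"
    unfolding cinner.rep_eq complex_norm_square ..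
  also have "\<dots> = complex_of_real (\<Sum>\<^sub>\<infinity>a. (cmod (coef x a))\<^sup>2)"
    using has_sum_of_real[OF has_sum_infsum] coef infsumI by blast
  finally show ?thesis .
qed

instance
proof
  fix x y z :: "'a ell2" and r s :: real
  show "x + y + z = x + (y + z)" "x + y = y + x" "0 + x = x" "- x + x = 0"
    by (transfer, simp add: fun_eq_iff add_ac)+
  show "x - y = x + - y" by (rule minus_ell2_def)
  show "r *\<^sub>R (x + y) = r *\<^sub>R x + r *\<^sub>R y" "(r + s) *\<^sub>R x = r *\<^sub>R x + s *\<^sub>R x"
    "r *\<^sub>R s *\<^sub>R x = (r * s) *\<^sub>R x" "1 *\<^sub>R x = x"
    unfolding scaleR_ell2_def by (transfer, simp add: fun_eq_iff algebra_simps)+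
  show "dist x y = norm (x - y)" by (rule dist_ell2_def)
  show "sgn x = inverse (norm x) *\<^sub>R x" by (rule sgn_ell2_def)
  show "uniformity = (INF e\<in>{0<..}. principal {(x :: 'a ell2, y). dist x y < e})"
    by (rule uniformity_ell2_def)
  show "open U \<longleftrightarrow> (\<forall>x\<in>U. \<forall>\<^sub>F (x', y) in uniformity. x' = x \<longrightarrow> y \<in> U)" for U :: "'a ell2 set"
    by (rule open_ell2_def)
  show "inner x y = inner y x"
    unfolding inner_ell2_def by (subst cinner_commute) simp
  show "inner (x + y) z = inner x z + inner y z"
    by (simp add: inner_ell2_def cinner_add_left)
  show "inner (r *\<^sub>R x) y = r * inner x y"
    by (simp add: inner_ell2_def scaleR_ell2_def cinner_scaleC_left)
  show "0 \<le> inner x x"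
    by (simp add: inner_ell2_def cinner_self infsum_nonneg)
  show "inner x x = 0 \<longleftrightarrow> x = 0"
  proof
    assume "inner x x = 0"
    then have "(\<Sum>\<^sub>\<infinity>a. (cmod (coef x a))\<^sup>2) = 0"
      by (simp add: inner_ell2_def cinner_self)
    then have "(cmod (coef x a))\<^sup>2 = 0" for a
      using coef[of x] by (intro nonneg_infsum_le_0D[of _ UNIV]) auto
    then show "x = 0"
      by (intro ell2_eqI) (simp add: zero_ell2.rep_eq)
  next
    assume "x = 0"
    then show "inner x x = 0"
      by (simp add: inner_ell2_def cinner_self zero_ell2.rep_eq)
  qed
  show "norm x = sqrt (inner x x)" by (rule norm_ell2_def)
qed

end

lemma norm_ell2_square: "(norm x)\<^sup>2 = (\<Sum>\<^sub>\<infinity>a. (cmod (coef x a))\<^sup>2)"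
  by (simp add: power2_norm_eq_inner inner_ell2_def cinner_self)

lemma scaleC_zero: "c *\<^sub>C 0 = (0 :: 'a ell2)"
  by transfer simp

lemma scaleC_add: "c *\<^sub>C (x + y) = c *\<^sub>C x + c *\<^sub>C (y :: 'a ell2)"
  by transfer (simp add: fun_eq_iff algebra_simps)

lemma scaleC_uminus: "c *\<^sub>C (- x) = - (c *\<^sub>C (x :: 'a ell2))"
  by transfer simp

lemma scaleC_diff: "c *\<^sub>C (x - y) = c *\<^sub>C x - c *\<^sub>C (y :: 'a ell2)"
  by (simp add: scaleC_add scaleC_uminus flip: add_uminus_conv_diff)

lemma cinner_add_right: "cinner x (y + z) = cinner x y + cinner x z"
  by (metis cinner_add_left cinner_commute complex_cnj_add)

lemma cinner_scaleC_right: "cinner x (c *\<^sub>C y) = cnj c * cinner x y"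
  by (metis cinner_commute cinner_scaleC_left complex_cnj_mult)

lemma cinner_eq_inner: "cinner x y = Complex (inner x y) (inner x (\<i> *\<^sub>C y))"
  by (simp add: inner_ell2_def cinner_scaleC_right complex_eq_iff)

lemma bounded_linear_cinner_left: "bounded_linear (\<lambda>x. cinner x y)"
proof -
  have "bounded_linear (\<lambda>x. of_real (inner x y) + \<i> * of_real (inner x (\<i> *\<^sub>C y)))"
    by (intro bounded_linear_add bounded_linear_const_mult
        bounded_linear_compose[OF bounded_linear_of_real] bounded_linear_inner_left)
  then show ?thesis
    by (simp add: cinner_eq_inner Complex_eq)
qed

lemma cinner_sum_left: "cinner (\<Sum>i\<in>I. f i) y = (\<Sum>i\<in>I. cinner (f i) y)"
  by (rule linear_sum[OF bounded_linear.linear[OF bounded_linear_cinner_left]])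

lemma cinner_delta: "cinner x (delta a) = coef x a"
proof -
  have "cinner x (delta a) = (\<Sum>\<^sub>\<infinity>b\<in>{a}. coef x b)"
    unfolding cinner.rep_eq by (rule infsum_cong_neutral) (auto simp: delta.rep_eq)
  then show ?thesis by simp
qed

lemma cinner_ext:
  assumes "\<And>x. cinner x y = cinner x z"
  shows "y = z"
  by (rule ell2_eqI) (metis assms cinner_commute cinner_delta)

lemma coef_sum_delta:
  assumes "finite F"
  shows "coef (\<Sum>a\<in>F. f a *\<^sub>C delta a) b = (if b \<in> F then f b else 0)"
  using assms
  by (induction F) (auto simp: plus_ell2.rep_eq zero_ell2.rep_eq scaleC.rep_eq delta.rep_eq)

lemma norm_sum_delta:
  assumes "finite F"
  shows "(norm (\<Sum>a\<in>F. f a *\<^sub>C delta a))\<^sup>2 = (\<Sum>a\<in>F. (cmod (f a))\<^sup>2)"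
proof -
  have "(norm (\<Sum>a\<in>F. f a *\<^sub>C delta a))\<^sup>2 = (\<Sum>\<^sub>\<infinity>a\<in>F. (cmod (f a))\<^sup>2)"
    unfolding norm_ell2_square by (rule infsum_cong_neutral) (auto simp: coef_sum_delta assms)
  then show ?thesis using assms by simp
qed

lemma has_sum_delta: "((\<lambda>a. coef x a *\<^sub>C delta a) has_sum x) UNIV"
proof -
  let ?p = "\<lambda>F. \<Sum>a\<in>F. coef x a *\<^sub>C delta a"
  let ?q = "\<lambda>F. \<Sum>a\<in>F. (cmod (coef x a))\<^sup>2"
  have n: "(norm (?p F - x))\<^sup>2 = (norm x)\<^sup>2 - ?q F" if "finite F" for F
  proof -
    have "cinner (?p F) x = (\<Sum>a\<in>F. complex_of_real ((cmod (coef x a))\<^sup>2))"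
      unfolding cinner_sum_left cinner_scaleC_left
      by (rule sum.cong) (simp, metis cinner_commute cinner_delta complex_norm_square)
    then have "inner (?p F) x = ?q F"
      by (simp add: inner_ell2_def)
    then show ?thesis
      using norm_sum_delta[OF that, of "coef x"]
      by (simp add: power2_norm_eq_inner inner_diff_left inner_diff_right inner_commute)
  qed
  have "(?q \<longlongrightarrow> (norm x)\<^sup>2) (finite_subsets_at_top UNIV)"
    using has_sum_infsum[of "\<lambda>a. (cmod (coef x a))\<^sup>2" UNIV] coef[of x]
    by (simp add: norm_ell2_square has_sum_def)
  from tendsto_diff[OF tendsto_const[of "(norm x)\<^sup>2"] this]
  have "((\<lambda>F. (norm x)\<^sup>2 - ?q F) \<longlongrightarrow> 0) (finite_subsets_at_top UNIV)"
    by simp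
  then have "((\<lambda>F. (norm (?p F - x))\<^sup>2) \<longlongrightarrow> 0) (finite_subsets_at_top UNIV)"
    by (rule Lim_transform_eventually)
       (auto simp: n intro!: eventually_finite_subsets_at_top_weakI)
  then have "((\<lambda>F. norm (?p F - x)) \<longlongrightarrow> 0) (finite_subsets_at_top UNIV)"
    using tendsto_real_sqrt[of "\<lambda>F. (norm (?p F - x))\<^sup>2" 0] by simp
  then show ?thesis
    unfolding has_sum_def by (simp add: tendsto_norm_zero_iff LIM_zero_iff)
qed

lemma translate_summable:
  fixes g :: "'g :: group_add"
  shows "(\<lambda>a. f (g + a)) summable_on UNIV \<longleftrightarrow> f summable_on UNIV"
    and "(\<Sum>\<^sub>\<infinity>a. f (g + a)) = (\<Sum>\<^sub>\<infinity>a. f a)"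
proof -
  have *: "bij (\<lambda>a. g + a)"
    by (rule bij_betw_byWitness[of _ "\<lambda>a. - g + a"]) (auto simp: add.assoc[symmetric])
  show "(\<lambda>a. f (g + a)) summable_on UNIV \<longleftrightarrow> f summable_on UNIV"
    by (rule summable_on_reindex_bij_betw[OF *])
  show "(\<Sum>\<^sub>\<infinity>a. f (g + a)) = (\<Sum>\<^sub>\<infinity>a. f a)"
    by (rule infsum_reindex_bij_betw[OF *])
qed

lift_definition translate :: "'g::group_add \<Rightarrow> 'g ell2 \<Rightarrow> 'g ell2"
  is "\<lambda>g f a. f (- g + a)"
  by (rule translate_summable(1)[THEN iffD2])

lemma norm_translate: "norm (translate g x) = norm x"
proof -
  have "(norm (translate g x))\<^sup>2 = (norm x)\<^sup>2"
    unfolding norm_ell2_square translate.rep_eq by (rule translate_summable(2))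
  then show ?thesis by simp
qed

lemma bounded_linear_translate: "bounded_linear (translate g)"
proof
  show "translate g (x + y) = translate g x + translate g y" for x y
    by transfer simp
  show "translate g (r *\<^sub>R x) = r *\<^sub>R translate g x" for r x
    unfolding scaleR_ell2_def by transfer simp
  show "\<exists>K. \<forall>x. norm (translate g x) \<le> norm x * K"
    by (rule exI[of _ 1]) (simp add: norm_translate)
qed

lemma translate_scaleC: "translate g (c *\<^sub>C x) = c *\<^sub>C translate g x"
  by transfer simp

lifting_forget ell2.lifting


section \<open>Bounded operators\<close>

text \<open>The elements of \<^typ>\<open>'a ell2 \<Rightarrow>\<^sub>L 'a ell2\<close> are only required to be real-linear.\<close>

typedef 'a bop = "{T :: 'a ell2 \<Rightarrow>\<^sub>L 'a ell2. \<forall>c x. blinfun_apply T (c *\<^sub>C x) = c *\<^sub>C blinfun_apply T x}"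
  morphisms blinfun_of Abs_bop
  by (rule exI[of _ id_blinfun]) simp

setup_lifting type_definition_bop

lift_definition app :: "'a bop \<Rightarrow> 'a ell2 \<Rightarrow> 'a ell2" is blinfun_apply .

lemma bop_eqI: "(\<And>x. app S x = app T x) \<Longrightarrow> S = T"
  by transfer (rule blinfun_eqI)

instantiation bop :: (type) ring_1
begin

lift_definition zero_bop :: "'a bop" is 0 by (simp add: scaleC_zero)

lift_definition one_bop :: "'a bop" is id_blinfun by simp

lift_definition plus_bop :: "'a bop \<Rightarrow> 'a bop \<Rightarrow> 'a bop" is "(+)"
  by (simp add: blinfun.add_left scaleC_add)

lift_definition minus_bop :: "'a bop \<Rightarrow> 'a bop \<Rightarrow> 'a bop" is "(-)"
  by (simp add: blinfun.diff_left scaleC_diff)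

lift_definition uminus_bop :: "'a bop \<Rightarrow> 'a bop" is uminus
  by (simp add: blinfun.minus_left scaleC_uminus)

lift_definition times_bop :: "'a bop \<Rightarrow> 'a bop \<Rightarrow> 'a bop" is "(o\<^sub>L)"
  by simp

instance
proof
  fix a b c :: "'a bop"
  show "a + b + c = a + (b + c)" "a + b = b + a" "0 + a = a" "- a + a = 0" "a - b = a + - b"
    by (transfer, simp)+
  show "a * b * c = a * (b * c)" "1 * a = a" "a * 1 = a"
    by (transfer, simp add: blinfun_eqI)+
  show "(a + b) * c = a * c + b * c" "a * (b + c) = a * b + a * c"
    by (transfer, rule blinfun_eqI, simp add: blinfun.add_left blinfun.add_right)+
  show "(0 :: 'a bop) \<noteq> 1"
  proof
    assume "(0 :: 'a bop) = 1"
    then have "app 0 (delta a) = app 1 (delta a)" for a :: 'a by simp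
    then have "delta a = 0" for a :: 'a by (simp add: app.rep_eq zero_bop.rep_eq one_bop.rep_eq)
    then have "coef (delta a) a = coef 0 a" for a :: 'a by simp
    then show False by (simp add: delta.rep_eq zero_ell2.rep_eq)
  qed
qed

end

definition adjoint :: "'a bop \<Rightarrow> 'a bop" where
  "adjoint T = (THE S. \<forall>x y. cinner (app T x) y = cinner x (app S y))"

lemma adjoint_exists: "\<exists>!S. \<forall>x y. cinner (app T x) y = cinner x (app S y)"
proof (rule ex_ex1I)
  have bl: "bounded_linear (app T)" and hom: "app T (c *\<^sub>C x) = c *\<^sub>C app T x" for c x
    using blinfun_of[of T] by (simp_all add: app.rep_eq blinfun.bounded_linear_right)
  obtain K where K: "norm (app T x) \<le> norm x * K" for x
    using bounded_linear.bounded[OF bl] by auto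
  define f where "f y a = cinner y (app T (delta a))" for y a
  have fin: "(\<Sum>a\<in>F. (cmod (f y a))\<^sup>2) \<le> (K * norm y)\<^sup>2" if F: "finite F" for F y
  proof -
    let ?x = "\<Sum>a\<in>F. f y a *\<^sub>C delta a"
    let ?S = "\<Sum>a\<in>F. (cmod (f y a))\<^sup>2"
    have "cinner (app T ?x) y = (\<Sum>a\<in>F. f y a * cnj (f y a))"
      unfolding linear_sum[OF bounded_linear.linear[OF bl]] hom cinner_sum_left cinner_scaleC_left
      by (simp add: f_def cinner_commute[symmetric])
    also have "\<dots> = complex_of_real ?S"
      by (simp add: complex_norm_square del: of_real_power)
    finally have "inner (app T ?x) y = ?S"
      by (simp add: inner_ell2_def)
    then have "?S \<le> norm (app T ?x) * norm y"
      using norm_cauchy_schwarz[of "app T ?x" y] by simp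
    also have "\<dots> \<le> norm ?x * K * norm y"
      by (intro mult_right_mono K) auto
    also have "norm ?x = sqrt ?S"
      unfolding norm_sum_delta[OF F, symmetric] by simp
    finally have *: "sqrt ?S * sqrt ?S \<le> sqrt ?S * (K * norm y)"
      by (simp add: sum_nonneg mult.assoc)
    show ?thesis
    proof (cases "?S = 0")
      case False
      then have "0 < sqrt ?S"
        by (simp add: sum_nonneg order_less_le)
      with * have "sqrt ?S \<le> K * norm y"
        by (simp only: mult_le_cancel_left_pos)
      then have "(sqrt ?S)\<^sup>2 \<le> (K * norm y)\<^sup>2"
        by (intro power_mono) (auto simp: sum_nonneg)
      then show ?thesis by (simp add: sum_nonneg)
    next
      case True
      then show ?thesis by simp
    qed
  qed
  have f_summable: "(\<lambda>a. (cmod (f y a))\<^sup>2) summable_on UNIV" for y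
    by (rule nonneg_bdd_above_summable_on)
       (auto intro!: bdd_aboveI[of _ "(K * norm y)\<^sup>2"] fin)
  define S where "S y = Abs_ell2 (f y)" for y
  have coef_S: "coef (S y) = f y" for y
    unfolding S_def by (rule Abs_ell2_inverse) (simp add: f_summable)
  have adj: "cinner (app T x) y = cinner x (S y)" for x y
  proof -
    have "bounded_linear (\<lambda>x. cinner (app T x) y)"
      by (rule bounded_linear_compose[OF bounded_linear_cinner_left bl])
    from has_sum_bounded_linear[OF this has_sum_delta[of x]]
    have "((\<lambda>a. coef x a * cnj (f y a)) has_sum cinner (app T x) y) UNIV"
      by (simp add: o_def hom cinner_scaleC_left f_def cinner_commute[symmetric])
    then show ?thesis
      unfolding cinner.rep_eq coef_S by (simp add: infsumI)
  qed
  have S_add: "S (x + y) = S x + S y" for x y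
    by (rule cinner_ext) (simp add: adj[symmetric] cinner_add_right)
  have S_scaleC: "S (c *\<^sub>C x) = c *\<^sub>C S x" for c x
    by (rule cinner_ext) (simp add: adj[symmetric] cinner_scaleC_right)
  have "norm (S y) \<le> norm y * K" for y
  proof (cases "S y = 0")
    case False
    have "norm (S y) * norm (S y) = inner (S y) (S y)"
      by (simp add: power2_norm_eq_inner[symmetric] power2_eq_square)
    also have "\<dots> = inner (app T (S y)) y"
      by (simp add: inner_ell2_def adj)
    also have "\<dots> \<le> norm (app T (S y)) * norm y"
      by (rule norm_cauchy_schwarz)
    also have "\<dots> \<le> norm (S y) * K * norm y"
      by (intro mult_right_mono K) auto
    finally have "norm (S y) * norm (S y) \<le> norm (S y) * (norm y * K)"
      by (simp add: ac_simps)
    moreover have "0 < norm (S y)" using False by simp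
    ultimately show ?thesis by (simp only: mult_le_cancel_left_pos)
  next
    case True
    have "0 \<le> norm (app T y)" by simp
    also have "\<dots> \<le> norm y * K" by (rule K)
    finally show ?thesis using True by simp
  qed
  then have "bounded_linear S"
    by (intro bounded_linear_intro[of _ K]) (auto simp: S_add scaleR_ell2_def S_scaleC)
  then have "app (Abs_bop (Blinfun S)) = S"
    by (simp add: app.rep_eq Abs_bop_inverse bounded_linear_Blinfun_apply S_scaleC)
  then show "\<exists>S. \<forall>x y. cinner (app T x) y = cinner x (app S y)"
    using adj by (intro exI[of _ "Abs_bop (Blinfun S)"]) simp
next
  fix S S' :: "'a bop"
  assume "\<forall>x y. cinner (app T x) y = cinner x (app S y)"
    "\<forall>x y. cinner (app T x) y = cinner x (app S' y)"
  then show "S = S'"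
    by (intro bop_eqI cinner_ext) metis
qed

lemma cinner_adjoint: "cinner (app T x) y = cinner x (app (adjoint T) y)"
  using theI'[OF adjoint_exists[of T]] unfolding adjoint_def by blast

definition unitary :: "'a bop \<Rightarrow> bool" where
  "unitary u \<longleftrightarrow> adjoint u * u = 1 \<and> u * adjoint u = 1"

text \<open>For unitary \<open>u\<close> the adjoint is the inverse, so this is the usual integer power.\<close>

definition unitary_power :: "'a bop \<Rightarrow> int \<Rightarrow> 'a bop" where
  "unitary_power u k = (if 0 \<le> k then u ^ nat k else adjoint u ^ nat (- k))"


section \<open>Von Neumann algebras and free independence\<close>

definition commutant :: "'a bop set \<Rightarrow> 'a bop set" where
  "commutant S = {T. \<forall>s\<in>S. T * s = s * T}"

definition vN_gen :: "'a bop set \<Rightarrow> 'a bop set" where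
  "vN_gen S = commutant (commutant (S \<union> adjoint ` S))"

definition haar_unitary :: "('a bop \<Rightarrow> complex) \<Rightarrow> 'a bop \<Rightarrow> bool" where
  "haar_unitary \<tau> u \<longleftrightarrow> unitary u \<and> (\<forall>k::int. k \<noteq> 0 \<longrightarrow> \<tau> (unitary_power u k) = 0)"

text \<open>
  Each factor of the product is tagged with the algebra it is taken from; consecutive factors come
  from different algebras.
\<close>

definition freely_independent ::
  "('a bop \<Rightarrow> complex) \<Rightarrow> 'a bop set \<Rightarrow> 'a bop set \<Rightarrow> bool" where
  "freely_independent \<tau> A B \<longleftrightarrow>
     (\<forall>ps :: (bool \<times> 'a bop) list.
        ps \<noteq> [] \<and> successively (\<lambda>p q. fst p \<noteq> fst q) ps \<and>
        (\<forall>(i, x) \<in> set ps. x \<in> (if i then A else B) \<and> \<tau> x = 0) \<longrightarrow>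
        \<tau> (prod_list (map snd ps)) = 0)"

text \<open>The weak FC property of a subalgebra \<open>A\<close> of a von Neumann algebra \<open>M\<close> with trace \<open>\<tau>\<close>.\<close>

definition weak_FC :: "'a bop set \<Rightarrow> ('a bop \<Rightarrow> complex) \<Rightarrow> 'a bop set \<Rightarrow> bool" where
  "weak_FC M \<tau> A \<longleftrightarrow>
     (\<exists>u\<in>M. haar_unitary \<tau> u \<and> freely_independent \<tau> (vN_gen {u}) A)"


section \<open>Free group factors and the radial MASA\<close>

text \<open>The left regular representation.\<close>

lift_definition lreg :: "'g::group_add \<Rightarrow> 'g bop" is "\<lambda>g. Blinfun (translate g)"
  unfolding bounded_linear_Blinfun_apply[OF bounded_linear_translate]
  by (simp add: translate_scaleC)

definition group_vN :: "'g::group_add bop set" where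
  "group_vN = vN_gen (range lreg)"

definition canonical_trace :: "'g::group_add bop \<Rightarrow> complex" where
  "canonical_trace T = cinner (app T (delta 0)) (delta 0)"

definition radial_masa :: "'n::finite free_group bop set" where
  "radial_masa = vN_gen {\<Sum>i\<in>UNIV. lreg (gen i) + adjoint (lreg (gen i))}"

end

theory Submission
  imports Defs
begin

text \<open>
  Let \<open>s i\<close> be \<open>sgn (Im u i)\<close>, a self-adjoint unitary in the algebra of the generator \<open>u i\<close>.  The
  radial generator is a sum of the even elements \<open>u i + u i*\<close>, whereas \<open>s i\<close> is an odd function.
  For \<open>i \<noteq> j\<close> the unitary \<open>s i s j\<close> is Haar by freeness of \<open>s i\<close> and \<open>s j\<close>.  An alternating product
  of its powers with reduced words in centred even letters stays, after merging neighbours over the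
  same generator, a reduced word in centred letters: \<open>s e\<close> and \<open>e s\<close> are centred since \<open>e\<close> is even
  and \<open>s\<close> is odd, and \<open>s e s\<close> is centred since \<open>s\<close> is a unitary.  Longer runs do not occur, because
  every nonzero power of \<open>s i s j\<close> involves both generators.  Hence its trace vanishes.
\<close>

section \<open>Bounded operators on square-summable functions\<close>

text \<open>Two points need an argument beyond the sketch. The algebras are double commutants, so
  their centred elements must be approximated by words in the generators. For this, the projection
  onto the orthogonal complement of the vectors of the words is shown to lie in the commutant; every
  element of the algebra commutes with it, which confines its vector to the closed span. Powers of
  the radial sum mix the generators, so the words used are those in all letters
  \<open>u i ^ k + u i ^ (- k)\<close>: a product of two cosines is a sum of two cosines, and so
  their span is stable under each summand of the radial sum. Freeness is thus obtained against all
  even elements at once. The sign function is built from its Fourier series. A vector whose right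
  translates are orthonormal defines an isometry by convolution, so unimodularity becomes
  orthogonality of the coefficient sequence to its shifts, and this is a telescoping sum.\<close>

lemma bounded_linear_app: "bounded_linear (app T)"
  by (simp add: app.rep_eq blinfun.bounded_linear_right)

lemmas app_diff = linear_diff[OF bounded_linear.linear[OF bounded_linear_app]]
lemmas app_zero = linear_0[OF bounded_linear.linear[OF bounded_linear_app]]

lemma app_one [simp]: "app 1 x = x"
  by (simp add: app.rep_eq one_bop.rep_eq)

lemma app_times [simp]: "app (S * T) x = app S (app T x)"
  by (simp add: app.rep_eq times_bop.rep_eq)

lemma app_plus: "app (S + T) x = app S x + app T x"
  by (simp add: app.rep_eq plus_bop.rep_eq blinfun.add_left)

lemma app_zero_bop: "app 0 x = 0"
  by (simp add: app.rep_eq zero_bop.rep_eq)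

lemma app_sum: "app (\<Sum>i\<in>I. T i) x = (\<Sum>i\<in>I. app (T i) x)"
  by (induction I rule: infinite_finite_induct) (simp_all add: app_zero_bop app_plus)

lemma cinner_zero_left [simp]: "cinner 0 x = 0"
  using bounded_linear.linear[OF bounded_linear_cinner_left[of x]] by (rule linear_0)

lemma cinner_zero_right [simp]: "cinner x 0 = 0"
  by (subst cinner_commute) simp

lemma cinner_diff_left: "cinner (x - y) z = cinner x z - cinner y z"
  using bounded_linear.linear[OF bounded_linear_cinner_left[of z]] by (rule linear_diff)

lemma cinner_diff_right: "cinner x (y - z) = cinner x y - cinner x z"
  by (metis cinner_commute cinner_diff_left complex_cnj_diff)

lemma cinner_delta_left: "cinner (delta a) x = cnj (coef x a)"
  by (metis cinner_commute cinner_delta)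

lemma coef_delta: "coef (delta a) b = (if b = a then 1 else 0)"
  by (simp add: delta.rep_eq)

lemma coef_plus: "coef (x + y) a = coef x a + coef y a"
  by (simp add: plus_ell2.rep_eq)

lemma coef_scaleC: "coef (c *\<^sub>C x) a = c * coef x a"
  by (simp add: scaleC.rep_eq)

lemma coef_minus: "coef (x - y) a = coef x a - coef y a"
  by (simp flip: cinner_delta add: cinner_diff_left)

lemma cinner_adjoint': "cinner (app (adjoint T) x) y = cinner x (app T y)"
  by (metis cinner_adjoint cinner_commute)

lemma adjoint_unique:
  assumes "\<And>x y. cinner (app T x) y = cinner x (app S y)"
  shows "adjoint T = S"
  using adjoint_exists[of T] cinner_adjoint[of T] assms by blast

lemma adjoint_adjoint [simp]: "adjoint (adjoint T) = T"
  by (rule adjoint_unique) (rule cinner_adjoint')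

lemma adjoint_times: "adjoint (S * T) = adjoint T * adjoint S"
  by (rule adjoint_unique) (simp add: cinner_adjoint)

lemma adjoint_plus: "adjoint (S + T) = adjoint S + adjoint T"
  by (rule adjoint_unique) (simp add: cinner_adjoint app_plus cinner_add_left cinner_add_right)

lemma adjoint_zero: "adjoint 0 = 0"
  by (rule adjoint_unique) (simp add: app_zero_bop)

lemma adjoint_sum: "adjoint (\<Sum>i\<in>I. T i) = (\<Sum>i\<in>I. adjoint (T i))"
  by (induction I rule: infinite_finite_induct) (simp_all add: adjoint_zero adjoint_plus)

text \<open>Coefficients of \<open>app (adjoint S) y\<close> are inner products of \<open>y\<close>
  with the vectors \<open>app S (delta a)\<close>; passing to adjoints replaces a density
  argument.\<close>

lemma bop_eq_deltaI:
  assumes "\<And>a. app S (delta a) = app T (delta a)"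
  shows "S = T"
proof -
  have "adjoint S = adjoint T"
  proof (intro bop_eqI ell2_eqI)
    fix y a
    show "coef (app (adjoint S) y) a = coef (app (adjoint T) y) a"
      by (metis assms cinner_adjoint' cinner_delta)
  qed
  then show ?thesis by (metis adjoint_adjoint)
qed

lemma bop_exists:
  assumes "\<And>x y. f (x + y) = f x + f y" "\<And>c x. f (c *\<^sub>C x) = c *\<^sub>C f x"
    and "\<And>x. norm (f x) \<le> norm x * K"
  shows "\<exists>T. app T = f"
proof -
  have "bounded_linear f"
    using assms by (intro bounded_linear_intro[of _ K]) (auto simp: scaleR_ell2_def)
  then have "app (Abs_bop (Blinfun f)) = f"
    by (simp add: app.rep_eq Abs_bop_inverse bounded_linear_Blinfun_apply assms)
  then show ?thesis ..
qed

lemma sum_coef_le_norm: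
  assumes "finite F"
  shows "(\<Sum>a\<in>F. (cmod (coef x a))\<^sup>2) \<le> (norm x)\<^sup>2"
  unfolding norm_ell2_square using coef[of x] assms
  by (intro finite_sum_le_infsum) auto

lemma norm_ell2_leI:
  assumes "\<And>F. finite F \<Longrightarrow> (\<Sum>a\<in>F. (cmod (coef x a))\<^sup>2) \<le> K\<^sup>2" "0 \<le> K"
  shows "norm x \<le> K"
proof -
  have "(norm x)\<^sup>2 \<le> K\<^sup>2"
    unfolding norm_ell2_square using coef[of x] assms by (intro infsum_le_finite_sums) auto
  then show ?thesis using assms(2) by (rule power2_le_imp_le)
qed

lemma ell2_exists:
  assumes "\<And>F. finite F \<Longrightarrow> (\<Sum>a\<in>F. (cmod (f a))\<^sup>2) \<le> K"
  shows "\<exists>x. coef x = f"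
proof -
  have "(\<lambda>a. (cmod (f a))\<^sup>2) summable_on UNIV"
    by (rule nonneg_bdd_above_summable_on) (auto intro!: bdd_aboveI[of _ K] assms)
  then have "coef (Abs_ell2 f) = f"
    by (intro Abs_ell2_inverse) simp
  then show ?thesis ..
qed

text \<open>Bessel's inequality makes the coefficient map a contraction. The operator is the adjoint
  of the isometry sending \<open>delta a\<close> to \<open>e a\<close>; right translations and the
  odd symmetries are both built this way.\<close>

lemma orthonormal_bop_exists:
  fixes e :: "'a \<Rightarrow> 'a ell2"
  assumes e: "\<And>a b. cinner (e a) (e b) = (if a = b then 1 else 0)"
  shows "\<exists>T. \<forall>x a. coef (app T x) a = cinner x (e a)"
proof -
  have bessel: "(\<Sum>a\<in>F. (cmod (cinner x (e a)))\<^sup>2) \<le> (norm x)\<^sup>2" if F: "finite F" for F x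
  proof -
    let ?q = "\<Sum>a\<in>F. (cmod (cinner x (e a)))\<^sup>2"
    \<comment> \<open>The projection of \<open>x\<close> onto the span of the \<open>e a\<close>
      with \<open>a\<close> in \<open>F\<close>. Its inner products with itself and with
      \<open>x\<close> agree, so Bessel follows from positivity of
      \<open>inner (x - y) (x - y)\<close>.\<close>
    define y where "y = (\<Sum>a\<in>F. cinner x (e a) *\<^sub>C e a)"
    have ye: "cinner y (e b) = cinner x (e b)" if "b \<in> F" for b
      using that F by (simp add: y_def cinner_sum_left cinner_scaleC_left e if_distrib cong: if_cong)
    have *: "cinner y z = of_real ?q" if "\<And>a. a \<in> F \<Longrightarrow> cinner z (e a) = cinner x (e a)" for z
    proof -
      have "cinner y z = (\<Sum>a\<in>F. cinner x (e a) * cnj (cinner z (e a)))"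
        by (simp add: y_def cinner_sum_left cinner_scaleC_left flip: cinner_commute)
      also have "\<dots> = of_real ?q"
        by (simp add: that complex_norm_square del: of_real_power)
      finally show ?thesis .
    qed
    have "inner y y = ?q" "inner y x = ?q"
      using *[of x] *[of y] ye by (simp_all add: inner_ell2_def)
    moreover have "0 \<le> inner (x - y) (x - y)" by simp
    ultimately show ?thesis
      by (simp add: power2_norm_eq_inner inner_diff_left inner_diff_right inner_commute)
  qed
  have "\<exists>y. coef y = (\<lambda>a. cinner x (e a))" for x
    using bessel by (rule ell2_exists)
  then obtain f where f: "\<And>x. coef (f x) = (\<lambda>a. cinner x (e a))"
    by metis
  have "\<exists>T. app T = f"
  proof (rule bop_exists)
    show "f (x + y) = f x + f y" for x y
      by (rule ell2_eqI) (simp add: f coef_plus cinner_add_left)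
    show "f (c *\<^sub>C x) = c *\<^sub>C f x" for c x
      by (rule ell2_eqI) (simp add: f coef_scaleC cinner_scaleC_left)
    show "norm (f x) \<le> norm x * 1" for x
      using bessel by (intro norm_ell2_leI) (auto simp: f)
  qed
  then show ?thesis using f by metis
qed


section \<open>Completeness and orthogonal projections\<close>

text \<open>Limits are taken coefficientwise; bounds over finite subsets survive the limit and give
  both square-summability and norm convergence.\<close>

instance ell2 :: (type) banach
proof
  fix X :: "nat \<Rightarrow> 'a ell2"
  assume X: "Cauchy X"
  have "Cauchy (\<lambda>n. coef (X n) a)" for a
  proof -
    have "bounded_linear (\<lambda>x. coef x a)"
      using bounded_linear_cinner_left[of "delta a"] by (simp add: cinner_delta)
    then show ?thesis by (rule bounded_linear.Cauchy) (rule X)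
  qed
  then have "\<exists>l. (\<lambda>n. coef (X n) a) \<longlonglongrightarrow> l" for a
    by (simp add: Cauchy_convergent_iff convergent_def)
  then obtain f where f: "\<And>a. (\<lambda>n. coef (X n) a) \<longlonglongrightarrow> f a"
    by metis
  have bound: "\<exists>N. \<forall>n\<ge>N. \<forall>F. finite F \<longrightarrow> (\<Sum>a\<in>F. (cmod (coef (X n) a - f a))\<^sup>2) \<le> \<epsilon>\<^sup>2"
    if \<epsilon>: "0 < \<epsilon>" for \<epsilon>
  proof -
    obtain N where N: "\<And>m n. m \<ge> N \<Longrightarrow> n \<ge> N \<Longrightarrow> norm (X m - X n) < \<epsilon>"
      using metric_CauchyD[OF X \<epsilon>] unfolding dist_norm by blast
    have "(\<Sum>a\<in>F. (cmod (coef (X n) a - f a))\<^sup>2) \<le> \<epsilon>\<^sup>2" if "n \<ge> N" "finite F" for n F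
    proof (rule LIMSEQ_le_const2)
      show "(\<lambda>m. \<Sum>a\<in>F. (cmod (coef (X n) a - coef (X m) a))\<^sup>2)
          \<longlonglongrightarrow> (\<Sum>a\<in>F. (cmod (coef (X n) a - f a))\<^sup>2)"
        by (intro tendsto_intros f)
      have "(\<Sum>a\<in>F. (cmod (coef (X n) a - coef (X m) a))\<^sup>2) \<le> \<epsilon>\<^sup>2" if "m \<ge> N" for m
      proof -
        have "(\<Sum>a\<in>F. (cmod (coef (X n) a - coef (X m) a))\<^sup>2) \<le> (norm (X n - X m))\<^sup>2"
          using sum_coef_le_norm[OF \<open>finite F\<close>, of "X n - X m"] by (simp add: coef_minus)
        also have "\<dots> \<le> \<epsilon>\<^sup>2"
          using N[OF \<open>n \<ge> N\<close> that] by (intro power_mono) auto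
        finally show ?thesis .
      qed
      then show "\<exists>M. \<forall>m\<ge>M. (\<Sum>a\<in>F. (cmod (coef (X n) a - coef (X m) a))\<^sup>2) \<le> \<epsilon>\<^sup>2"
        by blast
    qed
    then show ?thesis by blast
  qed
  obtain N where "\<And>F. finite F \<Longrightarrow> (\<Sum>a\<in>F. (cmod (coef (X N) a - f a))\<^sup>2) \<le> 1\<^sup>2"
    using bound[of 1] by auto
  then obtain y where y: "coef y = (\<lambda>a. coef (X N) a - f a)"
    using ell2_exists[of "\<lambda>a. coef (X N) a - f a"] by blast
  define l where "l = X N - y"
  have l: "coef l a = f a" for a
    by (simp add: l_def coef_minus y)
  have "X \<longlonglongrightarrow> l"
  proof (rule LIMSEQ_I)
    fix r :: real
    assume "0 < r"
    then obtain N where "\<And>n F. n \<ge> N \<Longrightarrow> finite F \<Longrightarrow>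
        (\<Sum>a\<in>F. (cmod (coef (X n) a - f a))\<^sup>2) \<le> (r / 2)\<^sup>2"
      using bound[of "r / 2"] by auto
    then have "norm (X n - l) \<le> r / 2" if "n \<ge> N" for n
      using that \<open>0 < r\<close> by (intro norm_ell2_leI) (auto simp: coef_minus l)
    then show "\<exists>N. \<forall>n\<ge>N. norm (X n - l) < r"
      using \<open>0 < r\<close> by (intro exI[of _ N]) force
  qed
  then show "convergent X" by (auto simp: convergent_def)
qed

text \<open>The parallelogram law makes a minimising sequence Cauchy, and minimality of its limit
  along every line in \<open>W\<close> forces orthogonality.\<close>

lemma closed_subspace_projection:
  fixes W :: "'a::{real_inner, banach} set"
  assumes "closed W" "subspace W"
  shows "\<exists>p\<in>W. \<forall>w\<in>W. inner (x - p) w = 0"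
proof -
  define D where "D = (INF w\<in>W. (norm (x - w))\<^sup>2)"
  have W0: "0 \<in> W" using assms(2) by (rule subspace_0)
  have bdd: "bdd_below ((\<lambda>w. (norm (x - w))\<^sup>2) ` W)"
    by (rule bdd_belowI[of _ 0]) auto
  have D: "D \<le> (norm (x - w))\<^sup>2" if "w \<in> W" for w
    unfolding D_def using bdd that by (rule cINF_lower)
  have "\<exists>w\<in>W. (norm (x - w))\<^sup>2 < D + \<epsilon>" if "0 < \<epsilon>" for \<epsilon>
    using cINF_less_iff[of W "\<lambda>w. (norm (x - w))\<^sup>2" "D + \<epsilon>"] W0 bdd that
    by (auto simp: D_def)
  then have "\<exists>w\<in>W. (norm (x - w))\<^sup>2 < D + inverse (real (Suc n))" for n
    by simp
  then obtain w where wW: "\<And>n. w n \<in> W"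
    and w: "\<And>n. (norm (x - w n))\<^sup>2 < D + inverse (real (Suc n))"
    by metis
  have close: "(norm (w m - w n))\<^sup>2 \<le> 2 * inverse (real (Suc m)) + 2 * inverse (real (Suc n))" for m n
  proof -
    have "(1/2) *\<^sub>R (w m + w n) \<in> W"
      using assms(2) wW by (intro subspace_scale subspace_add)
    then have "D \<le> (norm (x - (1/2) *\<^sub>R (w m + w n)))\<^sup>2"
      by (rule D)
    moreover have "(norm (w m - w n))\<^sup>2 = 2 * (norm (x - w m))\<^sup>2 + 2 * (norm (x - w n))\<^sup>2
        - 4 * (norm (x - (1/2) *\<^sub>R (w m + w n)))\<^sup>2"
      unfolding power2_norm_eq_inner
      by (simp add: inner_diff_left inner_diff_right inner_add_left inner_add_right
          inner_commute algebra_simps)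
    ultimately show ?thesis using w[of m] w[of n] by linarith
  qed
  have "Cauchy w"
  proof (rule CauchyI)
    fix e :: real
    assume "0 < e"
    then obtain N where N: "inverse (real (Suc N)) < e\<^sup>2 / 4"
      using reals_Archimedean[of "e\<^sup>2 / 4"] by auto
    have "norm (w m - w n) < e" if "m \<ge> N" "n \<ge> N" for m n
    proof -
      have "inverse (real (Suc m)) \<le> inverse (real (Suc N))"
        "inverse (real (Suc n)) \<le> inverse (real (Suc N))"
        using that by (auto intro!: le_imp_inverse_le)
      with close[of m n] N have "(norm (w m - w n))\<^sup>2 < e\<^sup>2" by linarith
      then show ?thesis using \<open>0 < e\<close> by (simp add: power_less_imp_less_base)
    qed
    then show "\<exists>M. \<forall>m\<ge>M. \<forall>n\<ge>M. norm (w m - w n) < e" by blast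
  qed
  then obtain p where p: "w \<longlonglongrightarrow> p"
    by (auto simp: Cauchy_convergent_iff convergent_def)
  have pW: "p \<in> W"
    using closed_sequentially[OF assms(1)] wW p by blast
  have "(norm (x - p))\<^sup>2 \<le> D + 0"
  proof (rule LIMSEQ_le)
    show "(\<lambda>n. (norm (x - w n))\<^sup>2) \<longlonglongrightarrow> (norm (x - p))\<^sup>2"
      by (intro tendsto_intros p)
    show "(\<lambda>n. D + inverse (real (Suc n))) \<longlonglongrightarrow> D + 0"
      by (intro tendsto_intros LIMSEQ_inverse_real_of_nat)
    show "\<exists>N. \<forall>n\<ge>N. (norm (x - w n))\<^sup>2 \<le> D + inverse (real (Suc n))"
      using w less_imp_le by blast
  qed
  then have p_min: "(norm (x - p))\<^sup>2 \<le> (norm (x - (p + v)))\<^sup>2" if "v \<in> W" for v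
    using D[of "p + v"] subspace_add[OF assms(2) pW that] by linarith
  have "inner (x - p) v = 0" if v: "v \<in> W" for v
  proof (cases "v = 0")
    case False
    \<comment> \<open>The parameter at which \<open>p + t *\<^sub>R v\<close> is closest to
      \<open>x\<close>.\<close>
    define t where "t = inner (x - p) v / (norm v)\<^sup>2"
    have tv: "t *\<^sub>R v \<in> W"
      using assms(2) v by (rule subspace_scale)
    have t: "t * (norm v)\<^sup>2 = inner (x - p) v"
      using False by (simp add: t_def)
    have "(norm (x - (p + t *\<^sub>R v)))\<^sup>2
        = (norm (x - p))\<^sup>2 - 2 * t * inner (x - p) v + t * (t * (norm v)\<^sup>2)"
      unfolding power2_norm_eq_inner
      by (simp add: inner_diff_left inner_diff_right inner_add_left inner_add_right
          inner_commute algebra_simps)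
    with p_min[OF tv] have "t * inner (x - p) v \<le> 0"
      by (simp add: t)
    then have "(inner (x - p) v)\<^sup>2 / (norm v)\<^sup>2 \<le> 0"
      by (simp add: t_def power2_eq_square)
    then have "(inner (x - p) v)\<^sup>2 \<le> 0"
      using False by (simp add: divide_le_0_iff)
    then show ?thesis by simp
  qed simp
  then show ?thesis using pW by blast
qed

text \<open>Real orthogonality becomes complex orthogonality since \<open>W\<close> contains
  \<open>\<i> *\<^sub>C w\<close> with each \<open>w\<close>. Through the uniqueness clause,
  commutation with other operators can later be checked by testing orthogonality.\<close>

lemma projection_bop_exists:
  assumes "closed W" "0 \<in> W" "\<And>x y. x \<in> W \<Longrightarrow> y \<in> W \<Longrightarrow> x + y \<in> W"
    and scale: "\<And>c x. x \<in> W \<Longrightarrow> c *\<^sub>C x \<in> W"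
  shows "\<exists>P. (\<forall>x. app P x \<in> W) \<and> (\<forall>x. \<forall>w\<in>W. cinner (x - app P x) w = 0) \<and>
    (\<forall>x q. q \<in> W \<longrightarrow> (\<forall>w\<in>W. cinner (x - q) w = 0) \<longrightarrow> app P x = q)"
proof -
  have sub: "subspace W"
    using assms by (auto simp: subspace_def scaleR_ell2_def)
  have "\<exists>p. p \<in> W \<and> (\<forall>w\<in>W. cinner (x - p) w = 0)" for x
    using closed_subspace_projection[OF assms(1) sub, of x] scale
    by (auto simp: cinner_eq_inner complex_eq_iff)
  then obtain p where pW: "\<And>x. p x \<in> W" and p: "\<And>x w. w \<in> W \<Longrightarrow> cinner (x - p x) w = 0"
    by metis
  have unique: "p x = q" if "q \<in> W" "\<And>w. w \<in> W \<Longrightarrow> cinner (x - q) w = 0" for x q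
  proof -
    have "p x - q \<in> W"
      using sub pW that(1) by (rule subspace_diff)
    then have "cinner (p x - q) (p x - q) = 0"
      using p[of "p x - q" x] that(2)[of "p x - q"] by (simp add: cinner_diff_left)
    then have "inner (p x - q) (p x - q) = 0" by (simp add: inner_ell2_def)
    then show ?thesis by simp
  qed
  have "\<exists>P. app P = p"
  proof (rule bop_exists)
    show "p (x + y) = p x + p y" for x y
      using p[of _ x] p[of _ y] pW assms(3)
      by (intro unique) (auto simp: cinner_diff_left cinner_add_left algebra_simps)
    show "p (c *\<^sub>C x) = c *\<^sub>C p x" for c x
      using p[of _ x] pW scale
      by (intro unique) (auto simp: cinner_scaleC_left simp flip: scaleC_diff)
    show "norm (p x) \<le> norm x * 1" for x
    proof -
      have "inner (x - p x) (p x) = 0"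
        using p[OF pW] by (simp add: inner_ell2_def)
      then have "norm (p x) * norm (p x) = inner x (p x)"
        by (simp add: inner_diff_left power2_norm_eq_inner flip: power2_eq_square)
      also have "\<dots> \<le> norm x * norm (p x)" by (rule norm_cauchy_schwarz)
      finally show ?thesis
        by (cases "p x = 0") (auto simp: mult_le_cancel_right_pos)
    qed
  qed
  then show ?thesis using p pW unique by metis
qed


section \<open>The regular representations and the trace\<close>

lemma coef_adjoint: "coef (app (adjoint T) x) a = cinner x (app T (delta a))"
  by (metis cinner_adjoint' cinner_delta)

lemma coef_lreg: "coef (app (lreg g) x) a = coef x (- g + a)"
  by (simp add: app.rep_eq lreg.rep_eq translate.rep_eq
      bounded_linear_Blinfun_apply[OF bounded_linear_translate])

lemma lreg_delta: "app (lreg g) (delta h) = delta (g + h)"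
  by (rule ell2_eqI) (auto simp: coef_lreg coef_delta add.assoc[symmetric])

lemma lreg_add: "lreg (g + h) = lreg g * lreg h"
  by (rule bop_eq_deltaI) (simp add: lreg_delta add.assoc)

lemma lreg_zero [simp]: "lreg 0 = 1"
  by (rule bop_eq_deltaI) (simp add: lreg_delta)

lemma adjoint_lreg: "adjoint (lreg g) = lreg (- g)"
  by (intro bop_eqI ell2_eqI) (simp add: coef_adjoint lreg_delta cinner_delta coef_lreg)

definition rreg :: "'g::group_add \<Rightarrow> 'g bop" where
  "rreg g = (SOME T. \<forall>x a. coef (app T x) a = cinner x (delta (a + g)))"

lemma coef_rreg: "coef (app (rreg g) x) a = coef x (a + g)"
proof -
  have "\<exists>T. \<forall>x a. coef (app T x) a = cinner x (delta (a + g))"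
    by (rule orthonormal_bop_exists) (auto simp: cinner_delta coef_delta)
  from someI_ex[OF this] show ?thesis
    by (simp add: rreg_def cinner_delta)
qed

lemma rreg_delta: "app (rreg g) (delta h) = delta (h - g)"
  by (rule ell2_eqI) (auto simp: coef_rreg coef_delta eq_diff_eq)

lemma adjoint_rreg: "adjoint (rreg g) = rreg (- g)"
  by (intro bop_eqI ell2_eqI) (simp add: coef_adjoint rreg_delta cinner_delta coef_rreg)

text \<open>The algebra in which traces are computed: its elements act as left convolution by their
  vector at \<open>delta 0\<close>.\<close>

definition right_invariant :: "'g::group_add bop set" where
  "right_invariant = commutant (range rreg)"

lemma right_invariantD: "T \<in> right_invariant \<Longrightarrow> T * rreg g = rreg g * T"
  by (auto simp: right_invariant_def commutant_def)

lemma right_invariantI: "(\<And>g. T * rreg g = rreg g * T) \<Longrightarrow> T \<in> right_invariant"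
  by (auto simp: right_invariant_def commutant_def)

lemma right_invariant_one [simp]: "1 \<in> right_invariant"
  by (rule right_invariantI) simp

lemma right_invariant_times:
  "S \<in> right_invariant \<Longrightarrow> T \<in> right_invariant \<Longrightarrow> S * T \<in> right_invariant"
  by (intro right_invariantI) (metis mult.assoc right_invariantD)

lemma right_invariant_plus:
  "S \<in> right_invariant \<Longrightarrow> T \<in> right_invariant \<Longrightarrow> S + T \<in> right_invariant"
  by (intro right_invariantI) (simp add: ring_distribs right_invariantD)

lemma right_invariant_sum:
  "(\<And>i. i \<in> I \<Longrightarrow> T i \<in> right_invariant) \<Longrightarrow> (\<Sum>i\<in>I. T i) \<in> right_invariant"
  by (intro right_invariantI) (simp add: sum_distrib_left sum_distrib_right right_invariantD)

lemma right_invariant_prod_list: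
  "(\<And>T. T \<in> set Ts \<Longrightarrow> T \<in> right_invariant) \<Longrightarrow> prod_list Ts \<in> right_invariant"
  by (induction Ts) (auto simp: right_invariant_times)

lemma right_invariant_adjoint:
  assumes "T \<in> right_invariant"
  shows "adjoint T \<in> right_invariant"
proof (rule right_invariantI)
  fix g :: 'a
  have "adjoint (rreg (- g) * T) = adjoint (T * rreg (- g))"
    using assms by (simp add: right_invariantD)
  then show "adjoint T * rreg g = rreg g * adjoint T"
    by (simp add: adjoint_times adjoint_rreg)
qed

lemma right_invariant_lreg: "lreg g \<in> right_invariant"
  by (intro right_invariantI bop_eqI ell2_eqI) (simp add: coef_rreg coef_lreg add.assoc)

lemma vN_gen_subset_right_invariant:
  assumes "S \<subseteq> right_invariant"
  shows "vN_gen S \<subseteq> right_invariant"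
proof -
  have "T * rreg g = rreg g * T" if "T \<in> S \<union> adjoint ` S" for T g
    using that assms by (auto intro!: right_invariantD dest: right_invariant_adjoint)
  then have "rreg g \<in> commutant (S \<union> adjoint ` S)" for g
    by (simp add: commutant_def)
  then show ?thesis
    by (auto simp: vN_gen_def commutant_def[of "commutant _"] intro!: right_invariantI)
qed

lemma coef_right_invariant:
  assumes "T \<in> right_invariant"
  shows "coef (app T (delta g)) h = coef (app T (delta 0)) (h - g)"
proof -
  have "app T (delta g) = app (T * rreg (- g)) (delta 0)"
    by (simp add: rreg_delta)
  also have "\<dots> = app (rreg (- g)) (app T (delta 0))"
    by (simp add: right_invariantD[OF assms])
  finally show ?thesis by (simp add: coef_rreg)
qed

lemma canonical_trace_coef: "canonical_trace T = coef (app T (delta 0)) 0"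
  by (simp add: canonical_trace_def cinner_delta)

lemma canonical_trace_lreg: "canonical_trace (lreg g) = (if g = 0 then 1 else 0)"
  by (simp add: canonical_trace_coef lreg_delta coef_delta)

lemma canonical_trace_plus: "canonical_trace (S + T) = canonical_trace S + canonical_trace T"
  by (simp add: canonical_trace_coef app_plus coef_plus)

lemma canonical_trace_times:
  "canonical_trace (S * T) = cinner (app T (delta 0)) (app (adjoint S) (delta 0))"
  by (simp add: canonical_trace_def cinner_adjoint)

lemma canonical_trace_times_infsum:
  assumes "S \<in> right_invariant"
  shows "canonical_trace (S * T) =
    (\<Sum>\<^sub>\<infinity>g. coef (app T (delta 0)) g * coef (app S (delta 0)) (- g))"
  unfolding canonical_trace_times cinner.rep_eq
  using coef_right_invariant[OF assms, of _ 0] by (simp add: coef_adjoint cinner_delta_left)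

text \<open>The trace of a product is a convolution evaluated at \<open>0\<close>; negating the
  summation variable exchanges the factors.\<close>

lemma canonical_trace_commute:
  assumes "S \<in> right_invariant" "T \<in> right_invariant"
  shows "canonical_trace (S * T) = canonical_trace (T * S)"
proof -
  have "bij (uminus :: 'a \<Rightarrow> 'a)"
    by (rule bij_betw_byWitness[of _ uminus]) auto
  from infsum_reindex_bij_betw[OF this,
      of "\<lambda>g. coef (app S (delta 0)) g * coef (app T (delta 0)) (- g)"]
  show ?thesis
    using assms by (simp add: canonical_trace_times_infsum mult.commute)
qed


section \<open>Spans in the 2-norm and alternating products\<close>

text \<open>
  The trace of a product depends on each factor separately through its vector in the 2-norm, so
  factors may be approximated one at a time without control of operator norms.  It suffices to
  express ``closure of the span'' by double orthogonality.
\<close>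

definition l2_span :: "'g::group_add bop set \<Rightarrow> 'g bop set" where
  "l2_span D = {T \<in> right_invariant. \<forall>y.
     (\<forall>z\<in>D. cinner (app z (delta 0)) y = 0) \<longrightarrow> cinner (app T (delta 0)) y = 0}"

lemma l2_span_base: "T \<in> D \<Longrightarrow> T \<in> right_invariant \<Longrightarrow> T \<in> l2_span D"
  by (auto simp: l2_span_def)

lemma l2_span_plus: "S \<in> l2_span D \<Longrightarrow> T \<in> l2_span D \<Longrightarrow> S + T \<in> l2_span D"
  by (auto simp: l2_span_def right_invariant_plus app_plus cinner_add_left)

lemma l2_span_sum:
  "(\<And>i. i \<in> I \<Longrightarrow> T i \<in> l2_span D) \<Longrightarrow> (\<Sum>i\<in>I. T i) \<in> l2_span D"
  by (auto simp: l2_span_def right_invariant_sum app_sum cinner_sum_left)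

text \<open>Cyclicity moves \<open>Q\<close> to the front, so the trace pairs the vector of the
  middle factor with one fixed vector. Vanishing on \<open>D\<close> then passes to \<open>T\<close>
  by double orthogonality.\<close>

lemma canonical_trace_l2_span:
  assumes "T \<in> l2_span D" "D \<subseteq> right_invariant" "P \<in> right_invariant" "Q \<in> right_invariant"
    and "\<And>z. z \<in> D \<Longrightarrow> canonical_trace (P * z * Q) = 0"
  shows "canonical_trace (P * T * Q) = 0"
proof -
  have cyc: "canonical_trace (P * z * Q) =
      cinner (app z (delta 0)) (app (adjoint (Q * P)) (delta 0))" if "z \<in> right_invariant" for z
    using canonical_trace_commute[of "P * z" Q] assms that
    by (simp add: right_invariant_times mult.assoc flip: canonical_trace_times)
  have "cinner (app z (delta 0)) (app (adjoint (Q * P)) (delta 0)) = 0" if "z \<in> D" for z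
    using that assms(2,5) cyc[of z] by auto
  then show ?thesis
    using assms(1) by (simp add: l2_span_def cyc)
qed

text \<open>Let \<open>W\<close> be the orthogonal complement of the vectors of \<open>1\<close> and
  \<open>D\<close>. By \<open>inv\<close> it is stable under \<open>S\<close> and its adjoints, so
  the projection \<open>P\<close> onto it lies in the commutant and commutes with \<open>T\<close>.
  As \<open>P\<close> kills \<open>delta 0\<close>, it kills the vector of \<open>T\<close>.\<close>

lemma vN_gen_l2_span:
  assumes S: "S \<subseteq> right_invariant"
    and D: "\<And>z. z \<in> D \<Longrightarrow> canonical_trace z = 0"
    and inv: "\<And>s z. s \<in> S \<union> adjoint ` S \<Longrightarrow> z \<in> insert 1 D \<Longrightarrow> s * z \<in> l2_span (insert 1 D)"
    and T: "T \<in> vN_gen S" "canonical_trace T = 0"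
  shows "T \<in> l2_span D"
proof -
  define W where "W = {y. \<forall>z\<in>insert 1 D. cinner (app z (delta 0)) y = 0}"
  have "W = (\<Inter>z\<in>insert 1 D. {y. cinner y (app z (delta 0)) = 0})"
    unfolding W_def by (subst cinner_commute) auto
  moreover have "closed {y. cinner y x = 0}" for x :: "'a ell2"
    using continuous_on_subset[OF linear_continuous_on[OF bounded_linear_cinner_left[of x]]]
    by (intro closed_Collect_eq) auto
  ultimately have "closed W" by auto
  then obtain P where PW: "\<And>x. app P x \<in> W"
    and P: "\<And>x w. w \<in> W \<Longrightarrow> cinner (x - app P x) w = 0"
    and uniq: "\<And>x q. q \<in> W \<Longrightarrow> (\<And>w. w \<in> W \<Longrightarrow> cinner (x - q) w = 0) \<Longrightarrow> app P x = q"
    using projection_bop_exists[of W]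
    by (auto simp: W_def cinner_add_right cinner_scaleC_right)
  have sW: "app s y \<in> W" if s: "s \<in> S \<union> adjoint ` S" and y: "y \<in> W" for s y
  proof -
    have "adjoint s \<in> S \<union> adjoint ` S" using s by auto
    with inv have "adjoint s * z \<in> l2_span (insert 1 D)" if "z \<in> insert 1 D" for z
      using that by blast
    then have "cinner (app (adjoint s * z) (delta 0)) y = 0" if "z \<in> insert 1 D" for z
      using that y unfolding l2_span_def W_def by blast
    then show ?thesis unfolding W_def app_times cinner_adjoint' by blast
  qed
  have "P \<in> commutant (S \<union> adjoint ` S)"
    unfolding commutant_def
  proof (intro CollectI ballI bop_eqI)
    fix s x
    assume s: "s \<in> S \<union> adjoint ` S"
    then have s': "adjoint s \<in> S \<union> adjoint ` S" by auto
    have "app P (app s x) = app s (app P x)"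
    proof (rule uniq)
      show "app s (app P x) \<in> W" by (intro sW s PW)
      show "cinner (app s x - app s (app P x)) w = 0" if "w \<in> W" for w
        using P[OF sW[OF s' that]] by (simp add: cinner_adjoint flip: app_diff)
    qed
    then show "app (P * s) x = app (s * P) x" by simp
  qed
  with T(1) have TP: "T * P = P * T"
    by (simp add: vN_gen_def commutant_def[of "commutant _"])
  have P0: "app P (delta 0) = 0"
    by (rule uniq) (auto simp: W_def)
  have TW: "cinner (app T (delta 0)) w = 0" if "w \<in> W" for w
  proof -
    have "app P (app T (delta 0)) = app (T * P) (delta 0)"
      by (simp add: TP)
    then have "app P (app T (delta 0)) = 0"
      by (simp add: P0 app_zero)
    with P[OF that, of "app T (delta 0)"] show ?thesis
      by simp
  qed
  have "cinner (app T (delta 0)) y = 0" if y: "\<forall>z\<in>D. cinner (app z (delta 0)) y = 0" for y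
  proof -
    \<comment> \<open>The correction gives orthogonality to the vector of \<open>1\<close>;
      orthogonality to \<open>D\<close> survives because elements of \<open>D\<close> have trace
      zero.\<close>
    have "y - coef y 0 *\<^sub>C delta 0 \<in> W"
      using y D by (auto simp: W_def cinner_diff_right cinner_scaleC_right cinner_delta
          cinner_delta_left coef_minus coef_scaleC coef_delta canonical_trace_coef)
    from TW[OF this] T(2) show ?thesis
      by (simp add: cinner_diff_right cinner_scaleC_right cinner_delta canonical_trace_coef)
  qed
  moreover have "T \<in> right_invariant"
    using T(1) vN_gen_subset_right_invariant[OF S] by blast
  ultimately show ?thesis by (simp add: l2_span_def)
qed

lemma trace_alternating_l2_span:
  fixes D :: "'i \<Rightarrow> 'g::group_add bop set"
  assumes D: "\<And>i. D i \<subseteq> right_invariant"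
    and "\<And>ps. ps \<noteq> [] \<Longrightarrow> distinct_adj (map fst ps) \<Longrightarrow> \<forall>p\<in>set ps. snd p \<in> D (fst p) \<Longrightarrow>
      canonical_trace (prod_list (map snd ps)) = 0"
    and "qs \<noteq> []" "distinct_adj (map fst qs)" "\<forall>q\<in>set qs. snd q \<in> l2_span (D (fst q))"
  shows "canonical_trace (prod_list (map snd qs)) = 0"
proof -
  \<comment> \<open>\<open>ps\<close> holds the factors already replaced by elements of the spanning
    sets, \<open>qs\<close> those still to be replaced.\<close>
  have "canonical_trace (prod_list (map snd (ps @ qs))) = 0"
    if "ps @ qs \<noteq> []" "distinct_adj (map fst (ps @ qs))"
      "\<forall>p\<in>set ps. snd p \<in> D (fst p)" "\<forall>q\<in>set qs. snd q \<in> l2_span (D (fst q))" for ps qs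
    using that
  proof (induction qs arbitrary: ps)
    case Nil
    then show ?case using assms(2) by simp
  next
    case (Cons q qs)
    have ps: "\<forall>p\<in>set ps. snd p \<in> right_invariant"
      using Cons.prems D by blast
    have "canonical_trace (prod_list (map snd ps) * snd q * prod_list (map snd qs)) = 0"
    proof (rule canonical_trace_l2_span)
      show "snd q \<in> l2_span (D (fst q))"
        using Cons.prems by simp
      show "prod_list (map snd ps) \<in> right_invariant" "prod_list (map snd qs) \<in> right_invariant"
        using Cons.prems ps by (auto intro!: right_invariant_prod_list simp: l2_span_def)
      show "canonical_trace (prod_list (map snd ps) * z * prod_list (map snd qs)) = 0"
        if "z \<in> D (fst q)" for z
        using Cons.IH[of "ps @ [(fst q, z)]"] Cons.prems that by (simp add: mult.assoc)
    qed (rule D)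
    then show ?case by (simp add: mult.assoc)
  qed
  from this[of "[]" qs] assms show ?thesis by simp
qed


section \<open>Odd self-adjoint unitaries\<close>

text \<open>\<open>orth\<close> makes the right translates of \<open>\<xi>\<close> orthonormal and
  \<open>herm\<close> makes the matrix of convolution by \<open>\<xi>\<close> Hermitian, so this
  convolution is a self-adjoint isometry and squares to \<open>1\<close>. It lies in
  \<open>group_vN\<close> because it commutes with everything that commutes with left
  translations.\<close>

lemma self_adjoint_unitary_exists:
  fixes \<xi> :: "'g::group_add ell2"
  assumes herm: "\<And>g. coef \<xi> (- g) = cnj (coef \<xi> g)"
    and orth: "\<And>g. cinner \<xi> (app (rreg g) \<xi>) = (if g = 0 then 1 else 0)"
  shows "\<exists>s\<in>group_vN. app s (delta 0) = \<xi> \<and> adjoint s = s \<and> s * s = 1"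
proof -
  define e where "e h = app (rreg (- h)) \<xi>" for h
  have rr: "app (rreg g) (app (rreg h) \<xi>) = app (rreg (g + h)) \<xi>" for g h
    by (rule ell2_eqI) (simp add: coef_rreg add.assoc)
  have coef_e: "coef (e h) a = coef \<xi> (a - h)" for h a
    by (simp add: e_def coef_rreg)
  have e: "cinner (e a) (e b) = (if a = b then 1 else 0)" for a b
  proof -
    have "cinner (e a) (e b) = cinner \<xi> (app (rreg (a - b)) \<xi>)"
      by (simp add: e_def cinner_adjoint adjoint_rreg rr)
    then show ?thesis by (simp add: orth)
  qed
  then obtain s where s: "\<And>x a. coef (app s x) a = cinner x (e a)"
    using orthonormal_bop_exists by blast
  have s_delta: "app s (delta g) = e g" for g
    by (rule ell2_eqI) (simp add: s cinner_delta_left coef_e flip: herm)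
  have "adjoint s = s"
    by (intro bop_eqI ell2_eqI) (simp add: coef_adjoint s_delta s)
  moreover have "s * s = 1"
    by (intro bop_eq_deltaI ell2_eqI) (simp add: s_delta s e coef_delta)
  moreover have "app s (delta 0) = \<xi>"
    by (rule ell2_eqI) (simp add: s_delta coef_e)
  moreover have "s * T = T * s" if T: "T \<in> commutant (range lreg \<union> adjoint ` range lreg)" for T
  proof (intro bop_eq_deltaI ell2_eqI)
    fix g h
    define f where "f = coef (app T (delta g))"
    \<comment> \<open>Commutation with left translations determines every column of the matrix of
      \<open>T\<close> from the column at \<open>g\<close>.\<close>
    have Tf: "coef (app T (delta a)) h = f (g - a + h)" for a
    proof -
      have "app T (delta a) = app (T * lreg (a - g)) (delta g)"
        by (simp add: lreg_delta)
      also have "T * lreg (a - g) = lreg (a - g) * T"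
        using T by (simp add: commutant_def)
      finally show ?thesis by (simp add: f_def coef_lreg)
    qed
    \<comment> \<open>This substitution turns the matrix entry of \<open>s * T\<close> into that of
      \<open>T * s\<close>.\<close>
    have "bij (\<lambda>a. g - a + h)"
      by (rule bij_betw_byWitness[of _ "\<lambda>b. h - b + g"])
         (auto simp only: diff_conv_add_uminus minus_add minus_minus add.assoc
            add_minus_cancel minus_add_cancel right_minus left_minus add_0_right)
    from infsum_reindex_bij_betw[OF this, of "\<lambda>b. f b * cnj (coef \<xi> (b - h))"]
    have "cinner (app T (delta g)) (e h) = (\<Sum>\<^sub>\<infinity>a. f (g - a + h) * cnj (coef \<xi> (g - a)))"
      by (simp add: cinner.rep_eq coef_e f_def)
    also have "\<dots> = cinner (e g) (app (adjoint T) (delta h))"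
      unfolding cinner.rep_eq[of "e g"]
      by (simp add: coef_e coef_adjoint cinner_delta_left Tf mult.commute flip: herm)
    also have "\<dots> = coef (app T (e g)) h"
      by (simp add: cinner_delta flip: cinner_adjoint)
    finally show "coef (app (s * T) (delta g)) h = coef (app (T * s) (delta g)) h"
      by (simp add: s s_delta)
  qed
  then have "s \<in> group_vN"
    unfolding group_vN_def vN_gen_def commutant_def[of "commutant _"] by blast
  ultimately show ?thesis by blast
qed

section \<open>Series over the odd integers\<close>

lemma summable_inverse_odd_squares: "(\<lambda>n::int. 1 / (2 * real_of_int n + 1)\<^sup>2) summable_on UNIV"
proof -
  let ?f = "\<lambda>n::int. 1 / (2 * real_of_int n + 1)\<^sup>2"
  have nat: "(\<lambda>n::nat. 1 / (2 * real n + 1)\<^sup>2) summable_on UNIV"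
  proof (subst summable_on_UNIV_nonneg_real_iff)
    show "summable (\<lambda>n. 1 / (2 * real n + 1)\<^sup>2)"
    proof (rule summable_comparison_test[OF _ sums_summable[OF inverse_squares_sums]])
      show "\<exists>N. \<forall>n\<ge>N. norm (1 / (2 * real n + 1)\<^sup>2) \<le> 1 / real ((n + 1)\<^sup>2)"
        by (intro exI[of _ 0]) (auto intro!: divide_left_mono power_mono simp del: of_nat_power simp: of_nat_power)
    qed
  qed auto
  have "?f summable_on range int"
    using nat by (subst summable_on_reindex) (auto simp: o_def)
  \<comment> \<open>Passing from \<open>n\<close> to \<open>- n - 1\<close> changes the sign of
    \<open>2 * n + 1\<close> and reaches the negative integers.\<close>
  moreover have "?f summable_on range (\<lambda>n. - int n - 1)"
    using nat by (subst summable_on_reindex) (auto simp: o_def inj_on_def power2_eq_square algebra_simps)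
  ultimately have "?f summable_on (range int \<union> range (\<lambda>n. - int n - 1))"
    by (rule summable_on_union)
  moreover have "range int \<union> range (\<lambda>n. - int n - 1) = UNIV"
  proof -
    have "k \<in> range int \<union> range (\<lambda>n. - int n - 1)" for k
    proof (cases "0 \<le> k")
      case True
      then have "k = int (nat k)" by simp
      then show ?thesis by blast
    next
      case False
      then have "k = - int (nat (- k - 1)) - 1" by simp
      then show ?thesis by blast
    qed
    then show ?thesis by blast
  qed
  ultimately show ?thesis by simp
qed

lemma filterlim_int_interval:
  "filterlim (\<lambda>N. {- int N..<int N}) (finite_subsets_at_top UNIV) sequentially"
proof (subst filterlim_finite_subsets_at_top, intro allI impI)
  fix X :: "int set"
  assume "finite X \<and> X \<subseteq> UNIV"
  then obtain B where "\<forall>x\<in>X. \<bar>x\<bar> \<le> B"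
    using member_le_sum[of _ X abs] by auto
  then have "X \<subseteq> {- int N..<int N}" if "N \<ge> nat (B + 1)" for N
    using that by (fastforce simp: abs_le_iff)
  then show "\<forall>\<^sub>F N in sequentially. finite {- int N..<int N} \<and> X \<subseteq> {- int N..<int N} \<and> {- int N..<int N} \<subseteq> UNIV"
    unfolding eventually_sequentially by blast
qed

lemma odd_int_nonzero: "2 * real_of_int n + 1 \<noteq> 0"
proof -
  have "2 * n + 1 \<noteq> 0" by presburger
  then show ?thesis by linarith
qed

text \<open>The two series diverge separately. For a shift by one the difference is absolutely
  summable and telescopes along symmetric intervals; other shifts follow by adding and
  translating.\<close>

lemma has_sum_odd_telescoping:
  fixes j :: int
  shows "((\<lambda>n::int. 1 / (2 * real_of_int n + 1) - 1 / (2 * real_of_int (n + j) + 1)) has_sum 0) UNIV"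
proof -
  define h where "h n = 1 / (2 * real_of_int n + 1)" for n :: int
  have shift: "((\<lambda>n. f (n + i)) has_sum x) UNIV \<longleftrightarrow> (f has_sum x) UNIV" for f :: "int \<Rightarrow> real" and i x
    by (rule has_sum_reindex_bij_betw) (rule bij_betw_byWitness[of _ "\<lambda>n. n - i"], auto)
  have sq: "(\<lambda>n. (h n)\<^sup>2) summable_on UNIV"
    using summable_inverse_odd_squares by (simp add: h_def power_divide)
  then have sq': "(\<lambda>n. (h (n + 1))\<^sup>2) summable_on UNIV"
    using shift[of "\<lambda>n. (h n)\<^sup>2" 1] by (simp add: summable_on_def)
  have one: "((\<lambda>n. h n - h (n + 1)) has_sum 0) UNIV"
  proof -
    have "(\<lambda>n. norm (h n - h (n + 1))) summable_on UNIV"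
    proof (rule summable_on_comparison_test)
      show "(\<lambda>n. (h n)\<^sup>2 + (h (n + 1))\<^sup>2) summable_on UNIV"
        by (intro summable_on_add sq sq')
      fix n
      have "h n - h (n + 1) = 2 * h n * h (n + 1)"
        using odd_int_nonzero[of n] odd_int_nonzero[of "n + 1"]
        by (simp add: h_def field_simps)
      moreover have "2 * \<bar>h n\<bar> * \<bar>h (n + 1)\<bar> \<le> (h n)\<^sup>2 + (h (n + 1))\<^sup>2"
        using sum_squares_bound[of "\<bar>h n\<bar>" "\<bar>h (n + 1)\<bar>"] by simp
      ultimately show "norm (h n - h (n + 1)) \<le> (h n)\<^sup>2 + (h (n + 1))\<^sup>2"
        by (simp add: abs_mult)
    qed auto
    then obtain x where x: "((\<lambda>n. h n - h (n + 1)) has_sum x) UNIV"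
      using abs_summable_summable summable_on_def by blast
    have telescope: "(\<Sum>n\<in>{- int N..<int N}. h n - h (n + 1)) = h (- int N) - h (int N)" for N
    proof (induction N)
      case (Suc N)
      have "{- int (Suc N)..<int (Suc N)} = insert (- int N - 1) (insert (int N) {- int N..<int N})"
        by auto
      moreover have "h (- int (Suc N)) = h (- int N - 1)" "h (int (Suc N)) = h (int N + 1)"
        by (rule arg_cong[of _ _ h], simp)+
      ultimately show ?case using Suc by simp
    qed simp
    have "((\<lambda>N. \<Sum>n\<in>{- int N..<int N}. h n - h (n + 1)) \<longlongrightarrow> x) sequentially"
      using x filterlim_int_interval unfolding has_sum_def by (rule filterlim_compose)
    moreover have "(\<lambda>N. \<Sum>n\<in>{- int N..<int N}. h n - h (n + 1)) \<longlonglongrightarrow> 0"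
    \<comment> \<open>At \<open>Suc N\<close> the left endpoint has odd number
      \<open>- (2 * N + 1)\<close>, so both boundary terms are values of \<open>h\<close> at
      naturals up to sign.\<close>
    proof (rule LIMSEQ_imp_Suc)
      have h0: "(\<lambda>N. h (int N)) \<longlonglongrightarrow> 0"
        by (rule Lim_null_comparison[OF _ LIMSEQ_inverse_real_of_nat])
           (auto simp: h_def divide_simps)
      have "h (- int (Suc N)) - h (int (Suc N)) = - h (int N) - h (int (Suc N))" for N
      proof -
        have "2 * real_of_int (- int (Suc N)) + 1 = - (2 * real_of_int (int N) + 1)" by simp
        then show ?thesis unfolding h_def by (simp only: divide_minus_right)
      qed
      moreover have "(\<lambda>N. - h (int N) - h (int (Suc N))) \<longlonglongrightarrow> - 0 - 0"
        by (intro tendsto_intros h0 LIMSEQ_Suc[OF h0])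
      ultimately show "(\<lambda>N. \<Sum>n\<in>{- int (Suc N)..<int (Suc N)}. h n - h (n + 1)) \<longlonglongrightarrow> 0"
        unfolding telescope by simp
    qed
    ultimately have "x = 0" by (rule LIMSEQ_unique)
    with x show ?thesis by simp
  qed
  have pos: "((\<lambda>n. h n - h (n + int m)) has_sum 0) UNIV" for m
  proof (induction m)
    case (Suc m)
    from has_sum_add[OF Suc one[THEN shift[of "\<lambda>n. h n - h (n + 1)" "int m", THEN iffD2]]]
    show ?case by (simp add: algebra_simps)
  qed (simp add: has_sum_0)
  have "((\<lambda>n. h n - h (n + j)) has_sum 0) UNIV"
  proof (cases "0 \<le> j")
    case True
    then show ?thesis using pos[of "nat j"] by simp
  next
    case False
    from pos[of "nat (- j)"] have "((\<lambda>n. h (n + j) - h n) has_sum 0) UNIV"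
      using False by (subst (asm) shift[symmetric, of _ _ j]) simp
    then show ?thesis
      using has_sum_cmult_right[of "\<lambda>n. h (n + j) - h n" UNIV 0 "- 1"] by simp
  qed
  then show ?thesis by (simp add: h_def)
qed


text \<open>
  The unitary below is the function \<open>sgn (sin t)\<close> on the circle, up to normalisation of its
  Fourier coefficients \<open>-\<i>/k\<close>, \<open>k\<close> odd.  An odd unimodular function cannot be continuous, so no
  finitely supported choice is possible.
\<close>

lemma odd_symmetry_exists:
  fixes \<phi> :: "int \<Rightarrow> 'g::group_add"
  assumes add: "\<And>m n. \<phi> (m + n) = \<phi> m + \<phi> n" and inj: "inj \<phi>"
  shows "\<exists>s\<in>group_vN. adjoint s = s \<and> s * s = 1 \<and>
    (\<forall>g. coef (app s (delta 0)) g \<noteq> 0 \<longrightarrow> g \<in> range \<phi>) \<and>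
    (\<forall>k. coef (app s (delta 0)) (\<phi> (- k)) = - coef (app s (delta 0)) (\<phi> k))"
proof -
  define A where "A = (\<Sum>\<^sub>\<infinity>n::int. 1 / (2 * real_of_int n + 1)\<^sup>2)"
  \<comment> \<open>\<open>sqrt A\<close> is half of \<open>pi\<close>, so \<open>b\<close> lists
    the Fourier coefficients of \<open>sgn (sin t)\<close> at odd frequencies; dividing by
    \<open>sqrt A\<close> yields a unit vector.\<close>
  define \<alpha> where "\<alpha> = 1 / sqrt A"
  define b where "b n = Complex 0 (- \<alpha> / (2 * real_of_int n + 1))" for n :: int
  define \<psi> where "\<psi> n = \<phi> (2 * n + 1)" for n
  define f where "f g = (if g \<in> range \<psi> then b (inv \<psi> g) else 0)" for g
  have "(\<Sum>n\<in>{0}. 1 / (2 * real_of_int n + 1)\<^sup>2) \<le> A"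
    unfolding A_def by (rule finite_sum_le_infsum[OF summable_inverse_odd_squares]) auto
  then have "0 < A" by simp
  then have \<alpha>: "\<alpha>\<^sup>2 * A = 1" by (simp add: \<alpha>_def power_divide)
  have inj': "inj \<psi>"
    by (rule injI) (auto simp: \<psi>_def dest: injD[OF inj])
  have f\<psi>: "f (\<psi> n) = b n" for n
    by (simp add: f_def inv_f_f[OF inj'])
  have \<phi>0: "\<phi> 0 = 0"
    using add[of 0 0] by (metis add.right_neutral add_left_cancel)
  have \<phi>m: "\<phi> (- k) = - \<phi> k" for k
    by (metis \<phi>0 add add.left_inverse eq_neg_iff_add_eq_0)
  have \<psi>m: "\<psi> (- n - 1) = - \<psi> n" for n
  proof -
    have "2 * (- n - 1) + 1 = - (2 * n + 1)" by simp
    then show ?thesis by (simp only: \<psi>_def \<phi>m)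
  qed
  have bm: "b (- n - 1) = - b n" for n
  proof -
    have "2 * real_of_int (- n - 1) + 1 = - (2 * real_of_int n + 1)" by simp
    moreover have "Complex 0 (- \<alpha> / - x) = - Complex 0 (- \<alpha> / x)" for x
      by (simp add: complex_eq_iff)
    ultimately show ?thesis by (simp only: b_def)
  qed
  have range_m: "- g \<in> range \<psi>" if "g \<in> range \<psi>" for g
  proof -
    obtain n where "g = \<psi> n" using \<open>g \<in> range \<psi>\<close> by blast
    then have "- g = \<psi> (- n - 1)" by (simp add: \<psi>m)
    then show ?thesis by blast
  qed
  have f_minus: "f (- g) = - f g" for g
  proof (cases "g \<in> range \<psi>")
    case True
    then obtain n where "g = \<psi> n" by blast
    then show ?thesis using f\<psi>[of "- n - 1"] f\<psi>[of n] by (simp add: \<psi>m bm)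
  next
    case False
    then show ?thesis using range_m[of "- g"] by (auto simp: f_def)
  qed
  have bb: "b n * cnj (b (n + j)) =
      of_real (\<alpha>\<^sup>2 * (1 / (2 * real_of_int n + 1) * (1 / (2 * real_of_int (n + j) + 1))))" for n j
    by (simp add: b_def complex_eq_iff power2_eq_square)
  have "(\<lambda>n. (cmod (b n))\<^sup>2) summable_on UNIV"
  proof -
    have "(\<lambda>n::int. \<alpha>\<^sup>2 * (1 / (2 * real_of_int n + 1)\<^sup>2)) summable_on UNIV"
      by (rule summable_on_cmult_right[OF summable_inverse_odd_squares])
    then show ?thesis by (simp add: b_def cmod_power2 power_divide)
  qed
  then have "(\<lambda>g. (cmod (f g))\<^sup>2) summable_on range \<psi>"
    by (subst summable_on_reindex[OF inj']) (simp add: o_def f\<psi>)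
  then have "(\<lambda>g. (cmod (f g))\<^sup>2) summable_on UNIV"
    by (rule summable_on_cong_neutral[THEN iffD1, rotated -1]) (auto simp: f_def)
  then have \<xi>: "coef (Abs_ell2 f) = f"
    by (intro Abs_ell2_inverse) simp
  have "cinner (Abs_ell2 f) (app (rreg g) (Abs_ell2 f)) = (if g = 0 then 1 else 0)" for g
  proof -
    have "cinner (Abs_ell2 f) (app (rreg g) (Abs_ell2 f)) = (\<Sum>\<^sub>\<infinity>a\<in>range \<psi>. f a * cnj (f (a + g)))"
      unfolding cinner.rep_eq coef_rreg \<xi>
      by (rule infsum_cong_neutral) (auto simp: f_def)
    also have "\<dots> = (\<Sum>\<^sub>\<infinity>n. b n * cnj (f (\<psi> n + g)))"
      by (subst infsum_reindex[OF inj']) (simp add: o_def f\<psi>)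
    also have "\<dots> = (if g = 0 then 1 else 0)"
    \<comment> \<open>Odd exponents differ by even ones, so the supports of the vector and its
      translate meet only in this case.\<close>
    proof (cases "\<exists>j. g = \<phi> (2 * j)")
      case True
      then obtain j where g: "g = \<phi> (2 * j)" by blast
      have "\<psi> n + g = \<psi> (n + j)" for n
        by (simp add: \<psi>_def g flip: add) (simp add: algebra_simps)
      then have *: "(\<Sum>\<^sub>\<infinity>n. b n * cnj (f (\<psi> n + g))) = (\<Sum>\<^sub>\<infinity>n. b n * cnj (b (n + j)))"
        by (simp add: f\<psi>)
      show ?thesis
      proof (cases "j = 0")
        case True
        have "((\<lambda>n. \<alpha>\<^sup>2 * (1 / (2 * real_of_int n + 1)\<^sup>2)) has_sum \<alpha>\<^sup>2 * A) UNIV"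
          unfolding A_def
          by (rule has_sum_cmult_right[OF has_sum_infsum[OF summable_inverse_odd_squares]])
        then have "((\<lambda>n. of_real (\<alpha>\<^sup>2 * (1 / (2 * real_of_int n + 1)\<^sup>2)) :: complex) has_sum of_real 1) UNIV"
          unfolding \<alpha> by (rule has_sum_of_real)
        then have "((\<lambda>n. b n * cnj (b (n + j))) has_sum 1) UNIV"
          unfolding bb using True by (simp add: power2_eq_square)
        then show ?thesis
          unfolding * using True g \<phi>0 by (simp add: infsumI)
      next
        case False
        \<comment> \<open>Partial fractions reduce the correlation to the telescoping
          series.\<close>
        have "1 / (2 * real_of_int n + 1) * (1 / (2 * real_of_int (n + j) + 1)) =
            1 / (2 * real_of_int j) *
              (1 / (2 * real_of_int n + 1) - 1 / (2 * real_of_int (n + j) + 1))" for n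
          using False odd_int_nonzero[of n] odd_int_nonzero[of "n + j"]
          by (simp add: divide_simps)
        then have eq: "b n * cnj (b (n + j)) = of_real (\<alpha>\<^sup>2 * (1 / (2 * real_of_int j) *
              (1 / (2 * real_of_int n + 1) - 1 / (2 * real_of_int (n + j) + 1))))" for n
          unfolding bb by (simp only:)
        have "((\<lambda>n. b n * cnj (b (n + j))) has_sum of_real (\<alpha>\<^sup>2 * (1 / (2 * real_of_int j) * 0))) UNIV"
          unfolding eq by (intro has_sum_of_real has_sum_cmult_right has_sum_odd_telescoping)
        moreover have "g \<noteq> 0"
          using False injD[OF inj, of "2 * j" 0] \<phi>0 by (auto simp: g)
        ultimately show ?thesis
          unfolding * by (simp add: infsumI)
      qed
    next
      case False
      have "\<psi> n + g \<notin> range \<psi>" for n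
      proof
        assume "\<psi> n + g \<in> range \<psi>"
        then obtain m where "\<psi> n + g = \<psi> m" by blast
        then have "g = - \<psi> n + \<psi> m"
          by (metis minus_add_cancel)
        also have "\<dots> = \<phi> (2 * (m - n))"
          by (simp add: \<psi>_def algebra_simps flip: \<phi>m add)
        finally show False using False by blast
      qed
      moreover have "g \<noteq> 0"
        using False \<phi>0 by (metis mult_zero_right)
      ultimately show ?thesis by (simp add: f_def)
    qed
    finally show ?thesis .
  qed
  \<comment> \<open>Odd and purely imaginary coefficients are Hermitian.\<close>
  moreover have "f (- g) = cnj (f g)" for g
    by (simp add: f_minus) (simp add: f_def b_def complex_eq_iff)
  ultimately obtain s where "s \<in> group_vN" "app s (delta 0) = Abs_ell2 f" "adjoint s = s" "s * s = 1"
    using self_adjoint_unitary_exists[of "Abs_ell2 f"] by (auto simp: \<xi>)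
  moreover have "g \<in> range \<phi>" if "f g \<noteq> 0" for g
    using that by (auto simp: f_def \<psi>_def split: if_splits)
  ultimately show ?thesis
    by (intro bexI[of _ s]) (auto simp: \<xi> \<phi>m f_minus)
qed


section \<open>Freeness of the generators\<close>

text \<open>Given directly as a reduced word, so that normal forms of alternating products can be
  read off; the sign chosen at \<open>k = 0\<close> is harmless because the list is empty.\<close>

lift_definition gen_power :: "'n \<Rightarrow> int \<Rightarrow> 'n free_group"
  is "\<lambda>i k. replicate (nat \<bar>k\<bar>) (i, 0 < k)"
proof -
  have "reduced (replicate m a)" for m and a :: "'n \<times> bool"
    by (induction m) (auto simp: reduced_Cons)
  then show "reduced (replicate (nat \<bar>k\<bar>) (i, 0 < k))" for i :: 'n and k by blast
qed

lemma gen_power_zero [simp]: "gen_power i 0 = 0"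
  by transfer simp

lemma gen_power_step: "gen_power i (k + 1) = gen i + gen_power i k"
proof transfer
  fix i :: 'n and k :: int
  show "replicate (nat \<bar>k + 1\<bar>) (i, 0 < k + 1) =
    foldr push [(i, True)] (replicate (nat \<bar>k\<bar>) (i, 0 < k))"
  proof (cases "0 \<le> k")
    case True
    then have "nat \<bar>k + 1\<bar> = Suc (nat \<bar>k\<bar>)" by simp
    moreover have "push a (replicate m a) = a # replicate m a" for m and a :: "'n \<times> bool"
      by (cases m) (simp_all add: push_def)
    ultimately show ?thesis using True by (cases "k = 0") (simp_all add: push_def[of _ "[]"])
  next
    case False
    then have "nat \<bar>k\<bar> = Suc (nat \<bar>k + 1\<bar>)" by simp
    then show ?thesis using False by (simp add: push_def flip_def)
  qed
qed

lemma gen_power_one: "gen_power i 1 = gen i"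
  using gen_power_step[of i 0] by simp

lemma gen_power_add: "gen_power i (m + n) = gen_power i m + gen_power i n"
proof (induction m rule: int_induct[where k = 0])
  case (step1 m)
  then show ?case
    using gen_power_step[of i "m + n"] gen_power_step[of i m] by (simp add: ac_simps add.assoc)
next
  case (step2 m)
  have pred: "gen_power i (k - 1) = - gen i + gen_power i k" for k
    using gen_power_step[of i "k - 1"] by (simp add: add.assoc[symmetric])
  show ?case
    using step2 pred[of "m + n"] pred[of m] by (simp add: algebra_simps)
qed simp

lemma gen_power_minus: "gen_power i (- k) = - gen_power i k"
  using gen_power_add[of i "- k" k] by (simp add: eq_neg_iff_add_eq_0)

lemma word_gen_power_eq_Nil_iff: "word (gen_power i k) = [] \<longleftrightarrow> k = 0"
  by (simp add: gen_power.rep_eq)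

lemma gen_power_eq_zero_iff: "gen_power i k = 0 \<longleftrightarrow> k = 0"
  by (metis word_gen_power_eq_Nil_iff gen_power_zero zero_free_group.rep_eq)

lemma inj_gen_power: "inj (gen_power i)"
proof (rule injI)
  fix m n
  assume "gen_power i m = gen_power i n"
  then have "gen_power i (m - n) = 0"
    using gen_power_add[of i m "- n"] by (simp add: gen_power_minus)
  then show "m = n" by (simp add: gen_power_eq_zero_iff)
qed

lemma foldr_push_replicate:
  assumes "reduced w" "w = [] \<or> hd w \<noteq> flip a"
  shows "foldr push (replicate m a) w = replicate m a @ w"
proof (induction m)
  case (Suc m)
  moreover have "push a (replicate m a @ w) = a # replicate m a @ w"
    using assms by (cases m; cases w) (auto simp: push_def)
  ultimately show ?case by simp
qed simp

text \<open>Powers of different generators do not cancel at a junction. The induction also carries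
  the generator of the first letter, on which the next junction depends.\<close>

lemma alternating_gen_powers_nonzero:
  assumes "l \<noteq> []" "distinct_adj (map fst l)" "\<forall>p\<in>set l. snd p \<noteq> 0"
  shows "(\<Sum>p\<leftarrow>l. gen_power (fst p) (snd p)) \<noteq> 0"
proof -
  have "word (\<Sum>p\<leftarrow>l. gen_power (fst p) (snd p)) \<noteq> [] \<and>
      fst (hd (word (\<Sum>p\<leftarrow>l. gen_power (fst p) (snd p)))) = fst (hd l)"
    using assms
  proof (induction l)
    case (Cons p l)
    define w where "w = word (\<Sum>p\<leftarrow>l. gen_power (fst p) (snd p))"
    define a where "a = (fst p, 0 < snd p)"
    have "w = [] \<or> hd w \<noteq> flip a"
    proof (cases "l = []")
      case False
      then have "fst (hd w) \<noteq> fst p"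
        using Cons by (cases l) (auto simp: w_def)
      then show ?thesis by (auto simp: a_def flip_def)
    qed (simp add: w_def zero_free_group.rep_eq)
    moreover have "reduced w" using word by (auto simp: w_def)
    ultimately have "word (\<Sum>p\<leftarrow>p # l. gen_power (fst p) (snd p)) = replicate (nat \<bar>snd p\<bar>) a @ w"
      by (simp add: plus_free_group.rep_eq gen_power.rep_eq foldr_push_replicate a_def
          del: foldr_replicate flip: w_def)
    moreover obtain m where "nat \<bar>snd p\<bar> = Suc m"
      using Cons.prems by (cases "nat \<bar>snd p\<bar>") auto
    ultimately show ?case by (simp add: a_def)
  qed simp
  then show ?thesis by (auto simp: zero_free_group.rep_eq)
qed

section \<open>Elements supported on a subgroup, and freeness of the generators\<close>

definition supported_in :: "'g::group_add set \<Rightarrow> 'g bop set" where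
  "supported_in H = {T \<in> right_invariant. \<forall>g. coef (app T (delta 0)) g \<noteq> 0 \<longrightarrow> g \<in> H}"

lemma supported_in_lreg: "g \<in> H \<Longrightarrow> lreg g \<in> supported_in H"
  by (auto simp: supported_in_def right_invariant_lreg lreg_delta coef_delta)

lemma supported_in_plus: "S \<in> supported_in H \<Longrightarrow> T \<in> supported_in H \<Longrightarrow> S + T \<in> supported_in H"
  unfolding supported_in_def
  by (simp add: right_invariant_plus app_plus coef_plus) (metis add_0_left)

lemma supported_in_times:
  assumes S: "S \<in> supported_in H" and T: "T \<in> supported_in H"
    and H: "\<And>g h. g \<in> H \<Longrightarrow> h \<in> H \<Longrightarrow> g + h \<in> H"
  shows "S * T \<in> supported_in H"
proof -
  have ri: "S \<in> right_invariant" "T \<in> right_invariant"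
    using S T by (auto simp: supported_in_def)
  have "coef (app (S * T) (delta 0)) g = 0" if "g \<notin> H" for g
  proof -
    have "coef (app (S * T) (delta 0)) g = cinner (app T (delta 0)) (app (adjoint S) (delta g))"
      by (simp add: cinner_delta flip: cinner_adjoint)
    also have "\<dots> = (\<Sum>\<^sub>\<infinity>a. coef (app T (delta 0)) a * coef (app S (delta 0)) (g - a))"
      unfolding cinner.rep_eq[of "app T _"]
      by (simp add: coef_adjoint cinner_delta_left coef_right_invariant[OF ri(1), of _ g])
    also have "\<dots> = 0"
    proof (rule infsum_0)
      fix a
      have "a \<notin> H \<or> g - a \<notin> H" using H[of "g - a" a] that by auto
      then show "coef (app T (delta 0)) a * coef (app S (delta 0)) (g - a) = 0"
        using S T by (auto simp: supported_in_def)
    qed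
    finally show ?thesis .
  qed
  then show ?thesis
    using right_invariant_times[OF ri] by (auto simp: supported_in_def)
qed

text \<open>The centred part of the von Neumann algebra of one generator, described through supports
  of vectors.\<close>

definition syllables :: "'n \<Rightarrow> 'n free_group bop set" where
  "syllables i = {T \<in> supported_in (range (gen_power i)). canonical_trace T = 0}"

text \<open>The trace is the coefficient at \<open>0\<close>, so a centred element has coefficients
  only at nonzero powers.\<close>

lemma syllables_l2_span: "syllables i \<subseteq> l2_span {lreg (gen_power i k) |k. k \<noteq> 0}"
proof
  fix T
  assume T: "T \<in> syllables i"
  have "cinner (app T (delta 0)) y = 0"
    if y: "\<And>k. k \<noteq> 0 \<Longrightarrow> cinner (app (lreg (gen_power i k)) (delta 0)) y = 0" for y
    unfolding cinner.rep_eq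
  proof (rule infsum_0)
    fix g
    show "coef (app T (delta 0)) g * cnj (coef y g) = 0"
    proof (rule ccontr)
      assume *: "coef (app T (delta 0)) g * cnj (coef y g) \<noteq> 0"
      then obtain k where g: "g = gen_power i k"
        using T by (auto simp: syllables_def supported_in_def)
      have "k \<noteq> 0"
        using T * by (auto simp: g syllables_def canonical_trace_coef)
      from y[OF this] show False
        using * by (simp add: g lreg_delta cinner_delta_left)
    qed
  qed
  moreover have "T \<in> right_invariant"
    using T by (simp add: syllables_def supported_in_def)
  ultimately show "T \<in> l2_span {lreg (gen_power i k) |k. k \<noteq> 0}"
    unfolding l2_span_def by blast
qed

text \<open>Freeness of the generators: with powers in place of syllables the product is a single
  nontrivial group element.\<close>

lemma trace_alternating_syllables:
  assumes "qs \<noteq> []" "distinct_adj (map fst qs)" "\<forall>q\<in>set qs. snd q \<in> syllables (fst q)"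
  shows "canonical_trace (prod_list (map snd qs)) = 0"
proof (rule trace_alternating_l2_span[where D = "\<lambda>i. {lreg (gen_power i k) |k. k \<noteq> 0}"])
  show "\<forall>q\<in>set qs. snd q \<in> l2_span {lreg (gen_power (fst q) k) |k. k \<noteq> 0}"
    using assms(3) by (intro ballI subsetD[OF syllables_l2_span]) blast
  fix ps :: "('a \<times> 'a free_group bop) list"
  assume ps: "ps \<noteq> []" "distinct_adj (map fst ps)"
    "\<forall>p\<in>set ps. snd p \<in> {lreg (gen_power (fst p) k) |k. k \<noteq> 0}"
  from ps(3) have "\<exists>l. map fst l = map fst ps \<and> (\<forall>p\<in>set l. snd p \<noteq> 0) \<and>
      prod_list (map snd ps) = lreg (\<Sum>p\<leftarrow>l. gen_power (fst p) (snd p))"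
  proof (induction ps)
    case (Cons p ps)
    have "\<forall>p\<in>set ps. snd p \<in> {lreg (gen_power (fst p) k) |k. k \<noteq> 0}"
      using Cons.prems by (intro ballI) (erule bspec, rule list.set_intros(2))
    from Cons.IH[OF this] obtain l where "map fst l = map fst ps" "\<forall>p\<in>set l. snd p \<noteq> 0"
      "prod_list (map snd ps) = lreg (\<Sum>p\<leftarrow>l. gen_power (fst p) (snd p))"
      by blast
    moreover obtain k where "snd p = lreg (gen_power (fst p) k)" "k \<noteq> 0"
      using bspec[OF Cons.prems list.set_intros(1)] by blast
    ultimately show ?case
      by (intro exI[of _ "(fst p, k) # l"]) (simp add: lreg_add)
  qed simp
  then obtain l where l: "map fst l = map fst ps" "\<forall>p\<in>set l. snd p \<noteq> 0"
    "prod_list (map snd ps) = lreg (\<Sum>p\<leftarrow>l. gen_power (fst p) (snd p))"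
    by blast
  have "l \<noteq> []" using l(1) ps(1) by auto
  with l ps(2) show "canonical_trace (prod_list (map snd ps)) = 0"
    by (simp add: canonical_trace_lreg alternating_gen_powers_nonzero)
qed (use assms in \<open>auto simp: right_invariant_lreg\<close>)


section \<open>Even letters and odd symmetries\<close>

text \<open>The function \<open>2 cos (k t)\<close> on the circle. At \<open>k = 0\<close> it is the
  scalar \<open>2\<close>, so only nonzero exponents give centred letters.\<close>

definition even_gen :: "'n \<Rightarrow> int \<Rightarrow> 'n free_group bop" where
  "even_gen i k = lreg (gen_power i k) + lreg (gen_power i (- k))"

lemma even_gen_one: "even_gen i 1 = lreg (gen i) + adjoint (lreg (gen i))"
  by (simp add: even_gen_def adjoint_lreg gen_power_minus gen_power_one)

lemma even_gen_zero: "even_gen i 0 = 1 + 1"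
  by (simp add: even_gen_def)

lemma even_gen_times: "even_gen i m * even_gen i n = even_gen i (m + n) + even_gen i (m - n)"
proof -
  have "lreg (gen_power i k) * lreg (gen_power i l) = lreg (gen_power i (k + l))" for k l
    by (simp add: gen_power_add lreg_add)
  then show ?thesis
    by (simp add: even_gen_def ring_distribs add_ac)
qed

text \<open>Allowing \<open>e s e\<close> over one generator would allow \<open>e s e s\<close>.
  Factors over one generator commute and \<open>s\<close> squares to \<open>1\<close>, so its trace
  is that of a product of two even letters, which can be nonzero.\<close>

fun no_ese :: "(bool \<times> 'n) list \<Rightarrow> bool" where
  "no_ese (a # b # c # ks) \<longleftrightarrow>
    \<not> (\<exists>i. a = (True, i) \<and> b = (False, i) \<and> c = (True, i)) \<and> no_ese (b # c # ks)"
| "no_ese _ \<longleftrightarrow> True"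

lemma no_ese_Cons_False: "\<not> fst k \<Longrightarrow> no_ese (k # ks) \<longleftrightarrow> no_ese ks"
  by (cases ks rule: no_ese.cases) auto

lemma no_ese_appendD: "no_ese (xs @ ys) \<Longrightarrow> no_ese ys"
proof (induction xs)
  case (Cons x xs)
  have "no_ese zs" if "no_ese (x # zs)" for zs
    using that by (cases zs rule: no_ese.cases) auto
  with Cons show ?case by simp
qed simp

lemma no_ese_append_False: "\<forall>k\<in>set xs. \<not> fst k \<Longrightarrow> no_ese ys \<Longrightarrow> no_ese (xs @ ys)"
  by (induction xs) (auto simp: no_ese_Cons_False)

text \<open>The pattern can cross the junction only if a single symmetry separates two even letters;
  two symmetries at the head of \<open>ys\<close> prevent this.\<close>

lemma no_ese_append_True:
  assumes "\<forall>k\<in>set xs. fst k"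
    and "ys = [] \<or> (\<exists>k k' ks. ys = k # k' # ks \<and> \<not> fst k \<and> \<not> fst k')" and "no_ese ys"
  shows "no_ese (xs @ ys)"
  using assms(1)
proof (induction xs)
  case (Cons x xs)
  show ?case
  proof (cases xs)
    case Nil
    then show ?thesis using assms(2,3) by auto
  next
    case (Cons x' xs')
    then show ?thesis using Cons.IH Cons.prems assms(2) by (cases "xs' @ ys") auto
  qed
qed (use assms(3) in simp)

text \<open>Factors carry a key: \<open>(True, i)\<close> for an even letter and \<open>(False, i)\<close> for the symmetry \<open>s i\<close>.\<close>

locale odd_symmetries =
  fixes s :: "'n::finite \<Rightarrow> 'n free_group bop"
  assumes s_vN: "s i \<in> group_vN"
    and adjoint_s: "adjoint (s i) = s i"
    and s_square: "s i * s i = 1"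
    and s_support: "coef (app (s i) (delta 0)) g \<noteq> 0 \<Longrightarrow> g \<in> range (gen_power i)"
    and s_odd: "coef (app (s i) (delta 0)) (gen_power i (- k)) =
      - coef (app (s i) (delta 0)) (gen_power i k)"
begin

section \<open>Regrouping admissible products into syllables\<close>

definition factors :: "bool \<times> 'n \<Rightarrow> 'n free_group bop set" where
  "factors p = (if fst p then {even_gen (snd p) k |k. k \<noteq> 0} else {s (snd p)})"

definition admissible :: "((bool \<times> 'n) \<times> 'n free_group bop) list \<Rightarrow> bool" where
  "admissible ts \<longleftrightarrow> distinct_adj (map fst ts) \<and> (\<forall>t\<in>set ts. snd t \<in> factors (fst t))"

lemma s_right_invariant: "s i \<in> right_invariant"
proof -
  have "group_vN \<subseteq> (right_invariant :: 'n free_group bop set)"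
    unfolding group_vN_def
    by (rule vN_gen_subset_right_invariant) (auto simp: right_invariant_lreg)
  then show ?thesis using s_vN by blast
qed

lemma even_gen_right_invariant: "even_gen i k \<in> right_invariant"
  by (simp add: even_gen_def right_invariant_plus right_invariant_lreg)

lemma factors_right_invariant: "x \<in> factors p \<Longrightarrow> x \<in> right_invariant"
  by (auto simp: factors_def s_right_invariant even_gen_right_invariant split: if_splits)

lemma runs_in_syllables:
  assumes "k \<noteq> 0"
  shows "even_gen i k \<in> syllables i" "s i \<in> syllables i" "even_gen i k * s i \<in> syllables i"
    "s i * even_gen i k \<in> syllables i" "s i * (even_gen i k * s i) \<in> syllables i"
proof -
  let ?H = "range (gen_power i)"
  have e: "even_gen i k \<in> supported_in ?H"
    unfolding even_gen_def by (intro supported_in_plus supported_in_lreg) auto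
  have s: "s i \<in> supported_in ?H"
    using s_support by (auto simp: supported_in_def s_right_invariant)
  have times: "S * T \<in> supported_in ?H" if "S \<in> supported_in ?H" "T \<in> supported_in ?H" for S T
    using that by (rule supported_in_times) (auto simp flip: gen_power_add)
  have e0: "canonical_trace (even_gen i k) = 0"
    using assms by (simp add: even_gen_def canonical_trace_plus canonical_trace_lreg gen_power_eq_zero_iff)
  \<comment> \<open>At exponent \<open>0\<close> oddness makes the coefficient equal to its own
    negative.\<close>
  have s0: "canonical_trace (s i) = 0"
    using s_odd[of i 0] by (simp add: canonical_trace_coef)
  \<comment> \<open>The two translates pick out coefficients of \<open>s i\<close> at opposite
    exponents, which cancel.\<close>
  have es0: "canonical_trace (even_gen i k * s i) = 0"
    using s_odd[of i k]
    by (simp add: even_gen_def canonical_trace_coef app_plus coef_plus coef_lreg flip: gen_power_minus)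
  have se0: "canonical_trace (s i * even_gen i k) = 0"
    using es0 canonical_trace_commute[OF s_right_invariant even_gen_right_invariant] by simp
  have ses0: "canonical_trace (s i * (even_gen i k * s i)) = 0"
    using e0 canonical_trace_commute[OF s_right_invariant[of i]
        right_invariant_times[OF even_gen_right_invariant[of i k] s_right_invariant[of i]]]
    by (simp add: mult.assoc s_square)
  show "even_gen i k \<in> syllables i" "s i \<in> syllables i" "even_gen i k * s i \<in> syllables i"
    "s i * even_gen i k \<in> syllables i" "s i * (even_gen i k * s i) \<in> syllables i"
    unfolding syllables_def using e s times e0 s0 es0 se0 ses0 by auto
qed

text \<open>The last conjunct records the generator of the first syllable, so that another run can
  be prepended while keeping the alternation.\<close>

definition regroups :: "((bool \<times> 'n) \<times> 'n free_group bop) list \<Rightarrow> bool" where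
  "regroups ts \<longleftrightarrow> (\<exists>qs. prod_list (map snd qs) = prod_list (map snd ts) \<and>
     distinct_adj (map fst qs) \<and> (\<forall>q\<in>set qs. snd q \<in> syllables (fst q)) \<and>
     (ts = [] \<longleftrightarrow> qs = []) \<and> (ts \<noteq> [] \<longrightarrow> fst (hd qs) = snd (fst (hd ts))))"

lemma regroups_append:
  assumes "regroups ts" "ts = [] \<or> snd (fst (hd ts)) \<noteq> i"
    and "prod_list (map snd rs) \<in> syllables i" "rs \<noteq> []" "snd (fst (hd rs)) = i"
  shows "regroups (rs @ ts)"
proof -
  obtain qs where "prod_list (map snd qs) = prod_list (map snd ts)"
    "distinct_adj (map fst qs)" "\<forall>q\<in>set qs. snd q \<in> syllables (fst q)"
    "ts = [] \<longleftrightarrow> qs = []" "ts \<noteq> [] \<longrightarrow> fst (hd qs) = snd (fst (hd ts))"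
    using assms(1) by (auto simp: regroups_def)
  with assms(2-) show ?thesis
    unfolding regroups_def
    by (intro exI[of _ "(i, prod_list (map snd rs)) # qs"]) (cases qs; auto)
qed

text \<open>
  The excluded pattern leaves only the runs \<open>e\<close>, \<open>s\<close>, \<open>es\<close>, \<open>se\<close>, \<open>ses\<close> over one generator.
\<close>

lemma admissible_regroups:
  assumes "admissible ts" "no_ese (map fst ts)"
  shows "regroups ts"
  using assms
proof (induction ts rule: length_induct)
  case (1 ts)
  \<comment> \<open>Splits off a first run over one generator and regroups the shorter rest by the
    induction hypothesis.\<close>
  have step: "regroups ts" if "ts = rs @ r" "r = [] \<or> snd (fst (hd r)) \<noteq> i"
    "prod_list (map snd rs) \<in> syllables i" "rs \<noteq> []" "snd (fst (hd rs)) = i" for rs r i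
  proof -
    have "regroups r"
      using 1 that(1,4) no_ese_appendD[of "map fst rs" "map fst r"]
      by (auto simp: admissible_def distinct_adj_append_iff)
    then show ?thesis using regroups_append that by blast
  qed
  show ?case
  proof (cases ts)
    case Nil
    then show ?thesis by (auto simp: regroups_def)
  next
    case (Cons t r)
    obtain b i x where t: "t = ((b, i), x)" by (metis surj_pair)
    have tx: "x \<in> factors (b, i)"
      using 1(2) by (simp add: admissible_def Cons t)
    show ?thesis
    proof (cases "r = [] \<or> snd (fst (hd r)) \<noteq> i")
      case True
      have "x \<in> syllables i"
        using tx runs_in_syllables(1)[of _ i] runs_in_syllables(2)[of 1 i]
        by (auto simp: factors_def split: if_splits)
      then show ?thesis
        using True by (intro step[of "[t]" r i]) (auto simp: Cons t)
    next
      case False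
      then obtain b' x' r' where r: "r = ((b', i), x') # r'"
        by (cases r) auto
      have b': "b' = (\<not> b)" and tx': "x' \<in> factors (b', i)"
        using 1(2) by (auto simp: admissible_def Cons t r)
      show ?thesis
      proof (cases "r' = [] \<or> snd (fst (hd r')) \<noteq> i")
        case True
        have "x * x' \<in> syllables i"
          using tx tx' b' runs_in_syllables(3,4)[of _ i]
          by (auto simp: factors_def split: if_splits)
        then show ?thesis
          using True by (intro step[of "[t, ((b', i), x')]" r' i]) (auto simp: Cons t r)
      next
        case False
        then obtain b'' x'' r'' where r': "r' = ((b'', i), x'') # r''"
          by (cases r') auto
        have b'': "b'' = b" and tx'': "x'' \<in> factors (b, i)"
          using 1(2) b' by (auto simp: admissible_def Cons t r r')
        \<comment> \<open>The three factors alternate in kind; starting with an even letter they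
          would form the excluded pattern.\<close>
        have b: "\<not> b"
          using 1(3) b' by (auto simp: Cons t r r' b'')
        \<comment> \<open>A fourth factor over \<open>i\<close> would make the second to fourth
          factors the excluded pattern.\<close>
        have "r'' = [] \<or> snd (fst (hd r'')) \<noteq> i"
        proof (rule ccontr)
          assume "\<not> ?thesis"
          then obtain b3 x3 r3 where r'': "r'' = ((b3, i), x3) # r3"
            by (cases r'') auto
          then have "b3 = b'"
            using 1(2) b b' b'' by (auto simp: admissible_def Cons t r r')
          then show False
            using 1(3) b b' b'' by (auto simp: Cons t r r' r'')
        qed
        moreover have "x * (x' * x'') \<in> syllables i"
          using tx tx' tx'' b b' runs_in_syllables(5)[of _ i]
          by (auto simp: factors_def)
        ultimately show ?thesis
          by (intro step[of "[t, ((b', i), x'), ((b'', i), x'')]" r'' i]) (auto simp: Cons t r r')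
      qed
    qed
  qed
qed

lemma canonical_trace_admissible:
  assumes "admissible ts" "no_ese (map fst ts)" "ts \<noteq> []"
  shows "canonical_trace (prod_list (map snd ts)) = 0"
proof -
  obtain qs where "prod_list (map snd qs) = prod_list (map snd ts)" "distinct_adj (map fst qs)"
    "\<forall>q\<in>set qs. snd q \<in> syllables (fst q)" "qs \<noteq> []"
    using admissible_regroups[OF assms(1,2)] assms(3) unfolding regroups_def by blast
  then show ?thesis
    using trace_alternating_syllables[of qs] by simp
qed

section \<open>Even words and powers of the Haar unitary\<close>

definition even_words :: "'n free_group bop set" where
  "even_words = {prod_list (map snd ts) |ts. ts \<noteq> [] \<and> admissible ts \<and> (\<forall>t\<in>set ts. fst (fst t))}"

text \<open>The nonzero integer powers of \<open>s i * s j\<close>, whose inverse is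
  \<open>s j * s i\<close>.\<close>

definition s_powers :: "'n \<Rightarrow> 'n \<Rightarrow> 'n free_group bop set" where
  "s_powers i j = {(s i * s j) ^ n |n. 0 < n} \<union> {(s j * s i) ^ n |n. 0 < n}"

lemma s_power_admissible:
  assumes "i \<noteq> j"
  shows "\<exists>ts. prod_list (map snd ts) = (s i * s j) ^ n \<and> admissible ts \<and>
    (\<forall>t\<in>set ts. \<not> fst (fst t)) \<and> length ts = 2 * n \<and> (ts = [] \<or> fst (hd ts) = (False, i))"
proof (induction n)
  case 0
  show ?case by (rule exI[of _ "[]"]) (simp add: admissible_def)
next
  case (Suc n)
  then obtain ts where "prod_list (map snd ts) = (s i * s j) ^ n" "admissible ts"
    "\<forall>t\<in>set ts. \<not> fst (fst t)" "length ts = 2 * n" "ts = [] \<or> fst (hd ts) = (False, i)"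
    by blast
  with assms show ?case
    by (intro exI[of _ "((False, i), s i) # ((False, j), s j) # ts"])
       (cases ts; auto simp: admissible_def factors_def mult.assoc)
qed

lemma s_powers_admissible:
  assumes "i \<noteq> j" "x \<in> s_powers i j"
  obtains ts where "prod_list (map snd ts) = x" "admissible ts" "\<forall>t\<in>set ts. \<not> fst (fst t)"
    "2 \<le> length ts"
proof -
  obtain n where "0 < n" "x = (s i * s j) ^ n \<or> x = (s j * s i) ^ n"
    using assms(2) by (auto simp: s_powers_def)
  moreover from this have "2 \<le> 2 * n" by simp
  ultimately show ?thesis
    using s_power_admissible[OF assms(1), of n] s_power_admissible[OF assms(1)[symmetric], of n] that
    by metis
qed

lemma admissible_append:
  assumes "admissible xs" "admissible ys" "xs = [] \<or> ys = [] \<or> fst (fst (last xs)) \<noteq> fst (fst (hd ys))"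
  shows "admissible (xs @ ys)"
proof (cases "xs = [] \<or> ys = []")
  case False
  then have "last (map fst xs) \<noteq> hd (map fst ys)"
    using assms(3) by (auto simp: last_map hd_map)
  then show ?thesis
    using assms(1,2) unfolding admissible_def
    by (simp add: distinct_adj_append_iff ball_Un)
qed (use assms in auto)

text \<open>Blocks alternate in kind, so concatenation stays admissible. The conclusion also records
  the head: a power contributes at least two symmetries, which is the hypothesis of
  \<open>no_ese_append_True\<close> when an even word is put in front.\<close>

lemma mixed_words_admissible:
  assumes "i \<noteq> j" "distinct_adj (map fst ps)"
    and "\<forall>p\<in>set ps. snd p \<in> (if fst p then s_powers i j else even_words)"
  shows "\<exists>ts. prod_list (map snd ts) = prod_list (map snd ps) \<and> admissible ts \<and>
    no_ese (map fst ts) \<and> (ps = [] \<longleftrightarrow> ts = []) \<and>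
    (ps \<noteq> [] \<longrightarrow> fst (fst (hd ts)) = (\<not> fst (hd ps)) \<and>
      (fst (hd ps) \<longrightarrow> (\<exists>t t' ts'. ts = t # t' # ts' \<and> \<not> fst (fst t) \<and> \<not> fst (fst t'))))"
  using assms(2,3)
proof (induction ps)
  case Nil
  show ?case by (rule exI[of _ "[]"]) (simp add: admissible_def)
next
  case (Cons p ps)
  have "distinct_adj (map fst ps)"
    using Cons.prems(1) by (cases ps) auto
  then obtain ts where ts: "prod_list (map snd ts) = prod_list (map snd ps)" "admissible ts"
    "no_ese (map fst ts)" "ps = [] \<longleftrightarrow> ts = []" and hd: "ps \<noteq> [] \<longrightarrow> fst (fst (hd ts)) = (\<not> fst (hd ps)) \<and>
      (fst (hd ps) \<longrightarrow> (\<exists>t t' ts'. ts = t # t' # ts' \<and> \<not> fst (fst t) \<and> \<not> fst (fst t')))"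
    using Cons.IH bspec[OF Cons.prems(2)] list.set_intros(2)[of _ ps p] by blast
  have alt: "ps = [] \<or> fst (hd ps) = (\<not> fst p)"
    using Cons.prems(1) by (cases ps) auto
  show ?case
  proof (cases "fst p")
    case True
    then obtain us where us: "prod_list (map snd us) = snd p" "admissible us"
      "\<forall>t\<in>set us. \<not> fst (fst t)" "2 \<le> length us"
      using s_powers_admissible[OF assms(1), of "snd p"] Cons.prems(2) by auto
    obtain t t' us' where us': "us = t # t' # us'"
      using us(4) by (cases us; cases "tl us") auto
    have "fst (fst (last us)) \<noteq> fst (fst (hd ts))" if "ts \<noteq> []"
      using us(3) us' ts(4) hd alt that True last_in_set[of us] by auto
    then have "admissible (us @ ts)"
      using admissible_append[OF us(2) ts(2)] by blast
    moreover have "no_ese (map fst us @ map fst ts)"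
      using us(3) ts(3) by (intro no_ese_append_False) auto
    moreover have "prod_list (map snd (us @ ts)) = prod_list (map snd (p # ps))"
      using us(1) ts(1) by simp
    ultimately show ?thesis
      using us(3) True by (intro exI[of _ "us @ ts"]) (simp add: us')
  next
    case False
    then obtain us where us: "prod_list (map snd us) = snd p" "us \<noteq> []" "admissible us"
      "\<forall>t\<in>set us. fst (fst t)"
      using bspec[OF Cons.prems(2), of p] unfolding even_words_def by auto
    have "fst (fst (last us)) \<noteq> fst (fst (hd ts))" if "ts \<noteq> []"
      using us(2,4) ts(4) hd alt that False last_in_set[of us] by auto
    then have "admissible (us @ ts)"
      using admissible_append[OF us(3) ts(2)] by blast
    moreover have "no_ese (map fst us @ map fst ts)"
    proof (rule no_ese_append_True)
      show "map fst ts = [] \<or> (\<exists>k k' ks. map fst ts = k # k' # ks \<and> \<not> fst k \<and> \<not> fst k')"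
      proof (cases "ps = []")
        case nonempty: False
        with hd alt False obtain t t' ts' where
          "ts = t # t' # ts'" "\<not> fst (fst t)" "\<not> fst (fst t')"
          by blast
        then show ?thesis by simp
      qed (use ts(4) in simp)
    qed (use us(4) ts(3) in auto)
    moreover have "prod_list (map snd (us @ ts)) = prod_list (map snd (p # ps))"
      using us(1) ts(1) by simp
    ultimately show ?thesis
      using us(2,4) False by (intro exI[of _ "us @ ts"]) simp
  qed
qed

lemma canonical_trace_mixed_words:
  assumes "i \<noteq> j" "distinct_adj (map fst ps)" "ps \<noteq> []"
    and "\<forall>p\<in>set ps. snd p \<in> (if fst p then s_powers i j else even_words)"
  shows "canonical_trace (prod_list (map snd ps)) = 0"
proof -
  obtain ts where "prod_list (map snd ts) = prod_list (map snd ps)" "admissible ts"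
    "no_ese (map fst ts)" "ts \<noteq> []"
    using mixed_words_admissible[OF assms(1,2,4)] assms(3) by blast
  then show ?thesis using canonical_trace_admissible[of ts] by simp
qed

section \<open>Closed spans of the two algebras\<close>

lemma even_words_right_invariant: "even_words \<subseteq> right_invariant"
  by (auto simp: even_words_def admissible_def intro!: right_invariant_prod_list
      dest!: factors_right_invariant)

lemma s_powers_right_invariant: "s_powers i j \<subseteq> right_invariant"
proof -
  have "x ^ n \<in> right_invariant" if "x \<in> right_invariant" for x :: "'n free_group bop" and n
    using that by (induction n) (auto intro: right_invariant_times)
  then show ?thesis
    by (auto simp: s_powers_def right_invariant_times s_right_invariant)
qed

text \<open>A letter over a different generator extends the word. Over the generator of the first
  letter the cosine formula gives exponents \<open>1 + k\<close> and \<open>1 - k\<close>; where one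
  of them is \<open>0\<close>, twice the remaining word is left.\<close>

lemma even_gen_even_words:
  assumes "z \<in> insert 1 even_words"
  shows "even_gen i 1 * z \<in> l2_span (insert 1 even_words)"
proof -
  have ri: "insert 1 even_words \<subseteq> right_invariant"
    using even_words_right_invariant by auto
  have word: "prod_list (map snd ts) \<in> l2_span (insert 1 even_words)"
    if "admissible ts" "\<forall>t\<in>set ts. fst (fst t)" for ts
  proof -
    have "prod_list (map snd ts) \<in> insert 1 even_words"
      using that by (cases "ts = []") (auto simp: even_words_def)
    then show ?thesis using ri by (blast intro: l2_span_base)
  qed
  have letter: "even_gen j k * prod_list (map snd ts) \<in> l2_span (insert 1 even_words)"
    if ts: "admissible ts" "\<forall>t\<in>set ts. fst (fst t)" "ts = [] \<or> snd (fst (hd ts)) \<noteq> j" for j k ts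
  proof (cases "k = 0")
    case True
    then show ?thesis
      using l2_span_plus[OF word[OF ts(1,2)] word[OF ts(1,2)]]
      by (simp add: even_gen_zero mult_2)
  next
    case False
    then have "admissible (((True, j), even_gen j k) # ts)"
      using ts by (cases ts) (auto simp: admissible_def factors_def)
    from word[OF this] show ?thesis using ts(2) by simp
  qed
  obtain ts where ts: "z = prod_list (map snd ts)" "admissible ts" "\<forall>t\<in>set ts. fst (fst t)"
  proof (cases "z = 1")
    case True
    then show ?thesis using that[of "[]"] by (simp add: admissible_def)
  next
    case False
    then show ?thesis using that assms by (auto simp: even_words_def)
  qed
  show ?thesis
  proof (cases "ts = [] \<or> snd (fst (hd ts)) \<noteq> i")
    case True
    then show ?thesis using letter ts by blast
  next
    case False
    then obtain x r where r: "ts = ((True, i), x) # r"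
      using ts(3) by (cases ts) auto
    obtain k where k: "x = even_gen i k"
      using ts(2) by (auto simp: admissible_def factors_def r)
    have rest: "admissible r" "\<forall>t\<in>set r. fst (fst t)" "r = [] \<or> snd (fst (hd r)) \<noteq> i"
      using ts(2,3) by (cases r; force simp: admissible_def r)+
    have "even_gen i 1 * z = (even_gen i 1 * even_gen i k) * prod_list (map snd r)"
      by (simp add: ts(1) r k mult.assoc)
    also have "\<dots> = even_gen i (1 + k) * prod_list (map snd r) + even_gen i (1 - k) * prod_list (map snd r)"
      by (simp only: even_gen_times distrib_right)
    finally show ?thesis
      using letter[OF rest] by (simp add: l2_span_plus)
  qed
qed

text \<open>Each summand of the radial generator preserves the span of \<open>1\<close> and the even
  words, hence so does the sum, and the projection argument of \<open>vN_gen_l2_span\<close>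
  applies.\<close>

lemma radial_masa_l2_span:
  assumes "T \<in> radial_masa" "canonical_trace T = 0"
  shows "T \<in> l2_span even_words"
proof -
  let ?x = "\<Sum>i\<in>UNIV. even_gen i 1 :: 'n free_group bop"
  have adj: "adjoint ?x = ?x"
    by (simp add: adjoint_sum even_gen_one adjoint_plus add.commute)
  show ?thesis
  proof (rule vN_gen_l2_span)
    show "{?x} \<subseteq> right_invariant"
      by (auto intro!: right_invariant_sum even_gen_right_invariant)
    show "T \<in> vN_gen {?x}"
      using assms(1) by (simp add: radial_masa_def even_gen_one)
    show "canonical_trace z = 0" if z: "z \<in> even_words" for z
    proof -
      obtain ts where ts: "z = prod_list (map snd ts)" "ts \<noteq> []" "admissible ts"
        "\<forall>t\<in>set ts. fst (fst t)"
        using z by (auto simp: even_words_def)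
      have "no_ese (map fst ts)"
        using no_ese_append_True[of "map fst ts" "[]"] ts(4) by auto
      then show ?thesis using ts canonical_trace_admissible by blast
    qed
    show "y * z \<in> l2_span (insert 1 even_words)"
      if "y \<in> {?x} \<union> adjoint ` {?x}" "z \<in> insert 1 even_words" for y z
      using that even_gen_even_words by (auto simp: adj sum_distrib_right intro!: l2_span_sum)
  qed (rule assms)
qed

lemma adjoint_s_times: "adjoint (s i * s j) = s j * s i"
  by (simp add: adjoint_times adjoint_s)

lemma s_times_inverse: "s i * s j * (s j * s i) = 1"
  by (metis mult.assoc mult_1_right s_square)

text \<open>The exponent rises by one, and from exponent \<open>-1\<close> the product reaches the
  identity.\<close>

lemma s_times_s_powers:
  assumes "z \<in> insert 1 (s_powers i j)"
  shows "s i * s j * z \<in> insert 1 (s_powers i j)"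
proof -
  have pow: "(s i * s j) ^ Suc n \<in> s_powers i j" "(s j * s i) ^ Suc n \<in> s_powers i j" for n
    unfolding s_powers_def by blast+
  consider "z = 1" | n where "z = (s i * s j) ^ Suc n" | n where "z = (s j * s i) ^ Suc n"
    using assms unfolding s_powers_def gr0_conv_Suc by blast
  then show ?thesis
  proof cases
    case 1
    then show ?thesis using pow(1)[of 0] by simp
  next
    case (2 n)
    then show ?thesis using pow(1)[of "Suc n"] by simp
  next
    case (3 n)
    then have "s i * s j * z = (s j * s i) ^ n"
      by (simp only: power_Suc s_times_inverse mult_1_left flip: mult.assoc[of "s i * s j"])
    then show ?thesis using pow(2)[of "n - 1"] by (cases n) auto
  qed
qed

lemma s_powers_commute: "s_powers i j = s_powers j i"
  by (auto simp: s_powers_def)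

lemma trace_s_powers:
  assumes "i \<noteq> j" "z \<in> s_powers i j"
  shows "canonical_trace z = 0"
proof -
  have "canonical_trace (prod_list (map snd [(True, z)])) = 0"
    using assms by (intro canonical_trace_mixed_words[of i j]) auto
  then show ?thesis by simp
qed

lemma vN_gen_s_times_l2_span:
  assumes "i \<noteq> j" "T \<in> vN_gen {s i * s j}" "canonical_trace T = 0"
  shows "T \<in> l2_span (s_powers i j)"
proof (rule vN_gen_l2_span)
  show "{s i * s j} \<subseteq> right_invariant"
    by (simp add: right_invariant_times s_right_invariant)
  show "y * z \<in> l2_span (insert 1 (s_powers i j))"
    if "y \<in> {s i * s j} \<union> adjoint ` {s i * s j}" "z \<in> insert 1 (s_powers i j)" for y z
  proof (rule l2_span_base)
    show *: "y * z \<in> insert 1 (s_powers i j)"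
      using that s_times_s_powers[of z i j] s_times_s_powers[of z j i]
      by (auto simp: adjoint_s_times s_powers_commute[of j i])
    show "y * z \<in> right_invariant"
      using * s_powers_right_invariant by auto
  qed
qed (use assms trace_s_powers in auto)

lemma weak_FC_radial_masa:
  fixes i j :: 'n
  assumes "i \<noteq> j"
  shows "weak_FC group_vN canonical_trace (radial_masa :: 'n free_group bop set)"
  unfolding weak_FC_def
proof (intro bexI conjI)
  show "s i * s j \<in> group_vN"
    using s_vN[of i] s_vN[of j]
    by (simp add: group_vN_def vN_gen_def commutant_def[of "commutant _"]) (metis mult.assoc)
  show "haar_unitary canonical_trace (s i * s j)"
    unfolding haar_unitary_def
  proof (intro conjI allI impI)
    show "unitary (s i * s j)"
      by (simp add: unitary_def adjoint_s_times s_times_inverse)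
    fix k :: int
    assume "k \<noteq> 0"
    then have "unitary_power (s i * s j) k \<in> s_powers i j"
      by (auto simp: unitary_power_def s_powers_def adjoint_s_times)
    then show "canonical_trace (unitary_power (s i * s j) k) = 0"
      using trace_s_powers[OF assms] by blast
  qed
  show "freely_independent canonical_trace (vN_gen {s i * s j}) radial_masa"
    unfolding freely_independent_def
  proof (intro allI impI)
    fix ps :: "(bool \<times> 'n free_group bop) list"
    assume *: "ps \<noteq> [] \<and> successively (\<lambda>p q. fst p \<noteq> fst q) ps \<and>
      (\<forall>(b, x)\<in>set ps. x \<in> (if b then vN_gen {s i * s j} else radial_masa) \<and> canonical_trace x = 0)"
    let ?D = "\<lambda>b. if b then s_powers i j else even_words"
    show "canonical_trace (prod_list (map snd ps)) = 0"
    \<comment> \<open>Elements of both algebras are replaced by words, for which the vanishing is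
      combinatorial.\<close>
    proof (rule trace_alternating_l2_span[where D = ?D])
      show "?D b \<subseteq> right_invariant" for b
        using even_words_right_invariant s_powers_right_invariant by simp
      show "distinct_adj (map fst ps)"
        using * by (simp add: distinct_adj_def successively_map)
      show "\<forall>q\<in>set ps. snd q \<in> l2_span (?D (fst q))"
        using * vN_gen_s_times_l2_span[OF assms] radial_masa_l2_span
        by (auto split: if_splits)
    qed (use * canonical_trace_mixed_words[OF assms] in auto)
  qed
qed

end

theorem corollary3p4:
  assumes "2 \<le> CARD('n::finite)"
  shows "weak_FC group_vN canonical_trace (radial_masa :: 'n free_group bop set)"
proof -
  have "\<not> card (UNIV :: 'n set) \<le> Suc 0"
    using assms by simp
  then obtain i j :: 'n where "i \<noteq> j"
    by (auto simp: card_le_Suc0_iff_eq)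
  have "\<exists>s. s \<in> group_vN \<and> adjoint s = s \<and> s * s = 1 \<and>
      (\<forall>g. coef (app s (delta 0)) g \<noteq> 0 \<longrightarrow> g \<in> range (gen_power i)) \<and>
      (\<forall>k. coef (app s (delta 0)) (gen_power i (- k)) = - coef (app s (delta 0)) (gen_power i k))"
    for i :: 'n
    using odd_symmetry_exists[of "gen_power i", OF gen_power_add inj_gen_power]
    unfolding Bex_def .
  then obtain s :: "'n \<Rightarrow> 'n free_group bop"
    where s: "\<And>i. s i \<in> group_vN \<and> adjoint (s i) = s i \<and> s i * s i = 1 \<and>
      (\<forall>g. coef (app (s i) (delta 0)) g \<noteq> 0 \<longrightarrow> g \<in> range (gen_power i)) \<and>
      (\<forall>k. coef (app (s i) (delta 0)) (gen_power i (- k)) =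
        - coef (app (s i) (delta 0)) (gen_power i k))"
    by metis
  have "odd_symmetries s"
    by (unfold_locales; use s in blast)
  then show ?thesis
    using \<open>i \<noteq> j\<close> by (rule odd_symmetries.weak_FC_radial_masa)
qed

end
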